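(* Suppose that $u\in C([0,T];W_0^{1,\infty}(\Omega))$, that the nodal points of the finite element spaces $\Psi_h^0,\dots,\Psi_h^{N_T}$ are given by a moving mesh, and that $\Delta t\,|u|_{C(W^{1,\infty})}\le1/8$. Let $F\in H^1(0,T;\Psi')$ be given. For a given $\phi_h^0\in\Psi_h^0$, let $\{\phi_h^n\}_{n=1}^{N_T}$, $\phi_h^n\in\Psi_h^n$, be the numerical solution of the first-order scheme $$\left(\frac{\phi_h^n-(\phi_h^{n-1}\circ X_1^n)\gamma^n}{\Delta t},\psi_h\right)+\nu(\nabla\phi_h^n,\nabla\psi_h)=\langle F^n,\psi_h\rangle\qquad\forall\psi_h\in\Psi_h^n,\quad n=1,\dots,N_T .$$ Then there exists a constant $C>0$ independent of $h$ and $\Delta t$ (and of $\phi_h$) such that $$\|\phi_h\|_{\ell^\infty(L^2)}+\sqrt{\nu}\,\|\nabla\phi_h\|_{\ell^2(L^2)}\le C\left(\|\phi_h^0\|+\|F\|_{\ell^2(\Psi_h')}\right).$$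
   Context: $\Omega=(a,b)$ is a bounded interval, $\Gamma=\{a,b\}$, $T>0$, $\nu>0$. $(\cdot,\cdot)$ and $\|\cdot\|$ are the inner product and norm of $L^2(\Omega)$, $\nabla=\partial_x$, $\Psi=H^1(\Omega)$ with dual $\Psi'$. $F(t)\in\Psi'$ is the functional $\langle F(t),\psi\rangle=(f(t),\psi)+\int_\Gamma g(t)\psi\,ds$ for given $f:\Omega\times(0,T)\to\mathbb{R}$, $g:\Gamma\times(0,T)\to\mathbb{R}$ with $f(t)\in L^2(\Omega)$, $g(t)\in L^2(\Gamma)$. $W_0^{1,\infty}(\Omega)$ consists of the $W^{1,\infty}(\Omega)$ functions vanishing at $a,b$, and $|u|_{C(W^{1,\infty})}=\sup_{t\in[0,T]}\|\partial_xu(\cdot,t)\|_{L^\infty(\Omega)}$. $\Delta t>0$, $t^n=n\Delta t$, $N_T=\lfloor T/\Delta t\rfloor$, $\rho^n=\rho(\cdot,t^n)$, $F^n=F(t^n)$. A moving mesh is a set of points $\{P_i^n: i=1,\dots,N_p,\ n=0,\dots,N_T\}\subset\bar\Omega$ with $a=P_1^n<\dots<P_{N_p}^n=b$ for every $n$; $h=\max_n\max_i(P_{i+1}^n-P_i^n)$. $\Psi_h^n\subset\Psi$ is the space of continuous functions on $\bar\Omega$ that are affine on each $[P_i^n,P_{i+1}^n]$, equipped with the $H^1(\Omega)$ norm, and $(\Psi_h^n)'$ is its dual. The upwind map is $X_1^n(x)=x-u^n(x)\Delta t$, with Jacobian $\gamma^n(x)=\partial_xX_1^n(x)$. Discrete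 norms: $\|\rho\|_{\ell^\infty(L^2)}=\max_{n=1,\dots,N_T}\|\rho^n\|$, $\|\rho\|_{\ell^2(L^2)}=\bigl(\Delta t\sum_{n=1}^{N_T}\|\rho^n\|^2\bigr)^{1/2}$, $\|F\|_{\ell^2(\Psi_h')}=\bigl(\Delta t\sum_{n=1}^{N_T}\|F^n\|^2_{(\Psi_h^n)'}\bigr)^{1/2}$. *)

theory Defs
  imports "HOL-Probability.Essential_Supremum"
begin

section \<open>Function spaces on a bounded interval\<close>

text \<open>
  Functions on the interval are total functions \<^typ>\<open>real \<Rightarrow> real\<close> of which only the values on
  the closed interval from \<open>a\<close> to \<open>b\<close> matter. All norms and inner products only depend on
  the class modulo null sets of the open interval.
\<close>

abbreviation Om :: "real \<Rightarrow> real \<Rightarrow> real measure" where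
  "Om a b \<equiv> lebesgue_on {a<..<b}"

definition L2 :: "real \<Rightarrow> real \<Rightarrow> (real \<Rightarrow> real) set" where
  "L2 a b = {f \<in> borel_measurable (Om a b). integrable (Om a b) (\<lambda>x. (f x)\<^sup>2)}"

definition L2_inner :: "real \<Rightarrow> real \<Rightarrow> (real \<Rightarrow> real) \<Rightarrow> (real \<Rightarrow> real) \<Rightarrow> real" where
  "L2_inner a b f g = (LINT x|Om a b. f x * g x)"

definition L2_norm :: "real \<Rightarrow> real \<Rightarrow> (real \<Rightarrow> real) \<Rightarrow> real" where
  "L2_norm a b f = sqrt (L2_inner a b f f)"

text \<open>
  The library's essential supremum is infinite on non-measurable functions, so finiteness of
  it includes measurability.
\<close>

definition Linf :: "real \<Rightarrow> real \<Rightarrow> (real \<Rightarrow> real) set" where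
  "Linf a b = {f. esssup (Om a b) (\<lambda>x. ereal \<bar>f x\<bar>) < \<infinity>}"

definition Linf_norm :: "real \<Rightarrow> real \<Rightarrow> (real \<Rightarrow> real) \<Rightarrow> real" where
  "Linf_norm a b f = real_of_ereal (esssup (Om a b) (\<lambda>x. ereal \<bar>f x\<bar>))"

definition test_function :: "real \<Rightarrow> real \<Rightarrow> (real \<Rightarrow> real) \<Rightarrow> bool" where
  "test_function a b \<eta> \<longleftrightarrow>
     (\<forall>k. (deriv ^^ k) \<eta> differentiable_on UNIV) \<and>
     (\<exists>K. compact K \<and> K \<subseteq> {a<..<b} \<and> (\<forall>x. x \<notin> K \<longrightarrow> \<eta> x = 0))"

text \<open>
  Integrability of both functions is demanded explicitly, because the Bochner integral of a
  non-integrable function is 0. On a bounded interval it is implied by membership in any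
  Lebesgue space.
\<close>

definition has_weak_deriv :: "real \<Rightarrow> real \<Rightarrow> (real \<Rightarrow> real) \<Rightarrow> (real \<Rightarrow> real) \<Rightarrow> bool" where
  "has_weak_deriv a b f v \<longleftrightarrow>
     integrable (Om a b) f \<and> integrable (Om a b) v \<and>
     (\<forall>\<eta>. test_function a b \<eta> \<longrightarrow>
        (LINT x|Om a b. f x * deriv \<eta> x) = - (LINT x|Om a b. v x * \<eta> x))"

text \<open>The weak derivative is unique up to null sets; some representative is chosen.\<close>

definition weak_deriv :: "real \<Rightarrow> real \<Rightarrow> (real \<Rightarrow> real) \<Rightarrow> (real \<Rightarrow> real)" where
  "weak_deriv a b f = (SOME v. has_weak_deriv a b f v)"

text \<open>
  Elements of one-dimensional Sobolev spaces are represented by their unique representative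
  that is continuous on the closed interval. Boundary values are the values of that
  representative.
\<close>

definition H1 :: "real \<Rightarrow> real \<Rightarrow> (real \<Rightarrow> real) set" where
  "H1 a b = {\<psi>. continuous_on {a..b} \<psi> \<and> \<psi> \<in> L2 a b \<and> (\<exists>v \<in> L2 a b. has_weak_deriv a b \<psi> v)}"

definition H1_norm :: "real \<Rightarrow> real \<Rightarrow> (real \<Rightarrow> real) \<Rightarrow> real" where
  "H1_norm a b \<psi> = sqrt ((L2_norm a b \<psi>)\<^sup>2 + (L2_norm a b (weak_deriv a b \<psi>))\<^sup>2)"

definition W1inf0 :: "real \<Rightarrow> real \<Rightarrow> (real \<Rightarrow> real) set" where
  "W1inf0 a b = {w. continuous_on {a..b} w \<and> w a = 0 \<and> w b = 0 \<and>
     w \<in> Linf a b \<and> (\<exists>v \<in> Linf a b. has_weak_deriv a b w v)}"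

definition W1inf_norm :: "real \<Rightarrow> real \<Rightarrow> (real \<Rightarrow> real) \<Rightarrow> real" where
  "W1inf_norm a b w = Linf_norm a b w + Linf_norm a b (weak_deriv a b w)"

text \<open>\<open>u t\<close> is the function \<open>u(\<cdot>,t)\<close>.\<close>

definition C_W1inf0 :: "real \<Rightarrow> real \<Rightarrow> real \<Rightarrow> (real \<Rightarrow> real \<Rightarrow> real) set" where
  "C_W1inf0 T a b = {u. (\<forall>t\<in>{0..T}. u t \<in> W1inf0 a b) \<and>
     (\<forall>t\<in>{0..T}. ((\<lambda>s. W1inf_norm a b (\<lambda>x. u s x - u t x)) \<longlongrightarrow> 0) (at t within {0..T}))}"

definition C_W1inf_seminorm :: "real \<Rightarrow> real \<Rightarrow> real \<Rightarrow> (real \<Rightarrow> real \<Rightarrow> real) \<Rightarrow> real" where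
  "C_W1inf_seminorm T a b u = (SUP t\<in>{0..T}. Linf_norm a b (weak_deriv a b (u t)))"

section \<open>Functionals\<close>

definition H1_dual :: "real \<Rightarrow> real \<Rightarrow> ((real \<Rightarrow> real) \<Rightarrow> real) set" where
  "H1_dual a b = {L.
     (\<forall>\<psi>\<in>H1 a b. \<forall>\<theta>\<in>H1 a b. L (\<lambda>x. \<psi> x + \<theta> x) = L \<psi> + L \<theta>) \<and>
     (\<forall>c. \<forall>\<psi>\<in>H1 a b. L (\<lambda>x. c * \<psi> x) = c * L \<psi>) \<and>
     (\<exists>K. \<forall>\<psi>\<in>H1 a b. \<bar>L \<psi>\<bar> \<le> K * H1_norm a b \<psi>)}"

text \<open>
  Norm of (the restriction of) a functional in the dual of a subspace \<open>V\<close> of \<open>H1\<close>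
  that carries the \<open>H1\<close> norm.
\<close>

definition dual_norm ::
  "real \<Rightarrow> real \<Rightarrow> (real \<Rightarrow> real) set \<Rightarrow> ((real \<Rightarrow> real) \<Rightarrow> real) \<Rightarrow> real" where
  "dual_norm a b V L = (SUP \<psi>\<in>{\<psi> \<in> V. H1_norm a b \<psi> \<le> 1}. \<bar>L \<psi>\<bar>)"

text \<open>
  The Lebesgue-Bochner space \<open>L2(0,T; H1')\<close>. The dual depends on \<open>a\<close> and \<open>b\<close> and hence is not
  a type, so strong measurability (pointwise a.e. approximation by simple functions) is
  spelled out.
\<close>

definition L2_H1_dual ::
  "real \<Rightarrow> real \<Rightarrow> real \<Rightarrow> (real \<Rightarrow> (real \<Rightarrow> real) \<Rightarrow> real) set" where
  "L2_H1_dual T a b = {F. (\<forall>t\<in>{0<..<T}. F t \<in> H1_dual a b) \<and>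
     (\<exists>s. (\<forall>k::nat. simple_function (lebesgue_on {0<..<T}) (s k) \<and>
                    (\<forall>t\<in>{0<..<T}. s k t \<in> H1_dual a b)) \<and>
          (AE t in lebesgue_on {0<..<T}.
             (\<lambda>k. dual_norm a b (H1 a b) (\<lambda>\<psi>. F t \<psi> - s k t \<psi>)) \<longlonglongrightarrow> 0)) \<and>
     (\<integral>\<^sup>+t. ennreal ((dual_norm a b (H1 a b) (F t))\<^sup>2) \<partial>lebesgue_on {0<..<T}) < \<infinity>}"

text \<open>
  The space \<open>H1(0,T; H1')\<close>, whose elements are represented by their representative that is
  continuous on the closed time interval. The identity of vector-valued integrals that defines
  the weak time derivative \<open>G\<close> is an identity between functionals and is written after
  application to an arbitrary \<open>\<psi>\<close>, which commutes with the Bochner integral.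
\<close>

definition H1_H1_dual ::
  "real \<Rightarrow> real \<Rightarrow> real \<Rightarrow> (real \<Rightarrow> (real \<Rightarrow> real) \<Rightarrow> real) set" where
  "H1_H1_dual T a b = {F. F \<in> L2_H1_dual T a b \<and>
     (\<exists>G \<in> L2_H1_dual T a b. \<forall>\<psi>\<in>H1 a b. \<forall>\<eta>. test_function 0 T \<eta> \<longrightarrow>
        (LINT t|lebesgue_on {0<..<T}. F t \<psi> * deriv \<eta> t)
          = - (LINT t|lebesgue_on {0<..<T}. G t \<psi> * \<eta> t)) \<and>
     (\<forall>t\<in>{0..T}. F t \<in> H1_dual a b \<and>
        ((\<lambda>s. dual_norm a b (H1 a b) (\<lambda>\<psi>. F s \<psi> - F t \<psi>)) \<longlongrightarrow> 0) (at t within {0..T}))}"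

section \<open>Finite elements on a moving mesh\<close>

definition num_steps :: "real \<Rightarrow> real \<Rightarrow> nat" where
  "num_steps T \<Delta>t = nat \<lfloor>T / \<Delta>t\<rfloor>"

definition moving_mesh :: "real \<Rightarrow> real \<Rightarrow> nat \<Rightarrow> nat \<Rightarrow> (nat \<Rightarrow> nat \<Rightarrow> real) \<Rightarrow> bool" where
  "moving_mesh a b N Np P \<longleftrightarrow> 2 \<le> Np \<and>
     (\<forall>n\<le>N. P n 1 = a \<and> P n Np = b \<and> strict_mono_on {1..Np} (P n))"

text \<open>Nodes of a single mesh are \<open>p 1, \<dots>, p Np\<close>.\<close>

definition fe_space :: "real \<Rightarrow> real \<Rightarrow> nat \<Rightarrow> (nat \<Rightarrow> real) \<Rightarrow> (real \<Rightarrow> real) set" where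
  "fe_space a b Np p = {\<psi>. continuous_on {a..b} \<psi> \<and>
     (\<forall>i\<in>{1..<Np}. \<exists>\<alpha> \<beta>. \<forall>x\<in>{p i..p (Suc i)}. \<psi> x = \<alpha> + \<beta> * x)}"

definition upwind :: "real \<Rightarrow> (real \<Rightarrow> real) \<Rightarrow> real \<Rightarrow> real" where
  "upwind \<Delta>t w x = x - w x * \<Delta>t"

definition scheme_solution ::
  "real \<Rightarrow> real \<Rightarrow> real \<Rightarrow> real \<Rightarrow> (real \<Rightarrow> real \<Rightarrow> real) \<Rightarrow> (real \<Rightarrow> (real \<Rightarrow> real) \<Rightarrow> real) \<Rightarrow> real
    \<Rightarrow> nat \<Rightarrow> (nat \<Rightarrow> nat \<Rightarrow> real) \<Rightarrow> (nat \<Rightarrow> real \<Rightarrow> real) \<Rightarrow> bool" where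
  "scheme_solution a b T \<nu> u F \<Delta>t Np P \<phi> \<longleftrightarrow>
     (\<forall>n\<in>{1..num_steps T \<Delta>t}.
        \<phi> n \<in> fe_space a b Np (P n) \<and>
        (let X = upwind \<Delta>t (u (real n * \<Delta>t)); \<gamma> = weak_deriv a b X in
         \<forall>\<psi>\<in>fe_space a b Np (P n).
           L2_inner a b (\<lambda>x. (\<phi> n x - \<phi> (n - 1) (X x) * \<gamma> x) / \<Delta>t) \<psi>
             + \<nu> * L2_inner a b (weak_deriv a b (\<phi> n)) (weak_deriv a b \<psi>)
           = F (real n * \<Delta>t) \<psi>))"

section \<open>Discrete norms\<close>

text \<open>The inserted 0 only matters for \<open>N = 0\<close>, where the maximum ranges over no time step.\<close>

definition linf_L2_norm :: "real \<Rightarrow> real \<Rightarrow> nat \<Rightarrow> (nat \<Rightarrow> real \<Rightarrow> real) \<Rightarrow> real" where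
  "linf_L2_norm a b N \<rho> = Max (insert 0 ((\<lambda>n. L2_norm a b (\<rho> n)) ` {1..N}))"

definition l2_L2_norm :: "real \<Rightarrow> real \<Rightarrow> real \<Rightarrow> nat \<Rightarrow> (nat \<Rightarrow> real \<Rightarrow> real) \<Rightarrow> real" where
  "l2_L2_norm a b \<Delta>t N \<rho> = sqrt (\<Delta>t * (\<Sum>n=1..N. (L2_norm a b (\<rho> n))\<^sup>2))"

definition l2_dual_norm ::
  "real \<Rightarrow> real \<Rightarrow> real \<Rightarrow> nat \<Rightarrow> nat \<Rightarrow> (nat \<Rightarrow> nat \<Rightarrow> real)
    \<Rightarrow> (real \<Rightarrow> (real \<Rightarrow> real) \<Rightarrow> real) \<Rightarrow> real" where
  "l2_dual_norm a b \<Delta>t N Np P F =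
     sqrt (\<Delta>t * (\<Sum>n=1..N. (dual_norm a b (fe_space a b Np (P n)) (F (real n * \<Delta>t)))\<^sup>2))"

end

(*
  Test the scheme with \<phi>_n itself. The transported function Y = (\<phi>_(n-1) o X) \<gamma> satisfies
  |Y|^2 \<le> (sup \<gamma>) |\<phi>_(n-1)|^2 \<le> (1 + \<Delta>t |u|) |\<phi>_(n-1)|^2, because X is a nondecreasing Lipschitz map of
  [a,b] onto itself and \<gamma> = X', so one factor \<gamma> is absorbed by a change of variables. The
  functional is bounded by its dual norm and Young's inequality with a weight \<epsilon> \<le> \<nu>, and a
  discrete Gronwall argument concludes.

  The analytic input is that a continuous function on [a,b] is the integral of its weak
  derivative. It comes from testing with smooth bumps that converge boundedly to the indicator
  of (c,d) and whose derivatives converge to the difference of the Dirac measures at c and d.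
*)
theory Submission
  imports Defs "HOL-Real_Asymp.Real_Asymp"
begin

text \<open>Since \<open>weak_deriv\<close> is an arbitrary choice, properties of \<gamma> are
  accessible only almost everywhere and only through uniqueness of weak derivatives. The integral
  formula for weak derivatives supplies this uniqueness, and also the monotonicity and the Lipschitz
  bound of X. As X may fail to be differentiable on a null set, the classical substitution rule is
  not applied; a constancy argument takes its place. Of the two factors \<gamma> in |Y|^2 one is
  used up by the substitution, and the other costs a factor \<open>1 + \<Delta>t * M\<close> per
  step. There are at most \<open>T / \<Delta>t\<close> steps, so these factors multiply to at most
  \<open>exp (M * T)\<close>, whatever \<Delta>t is. The mesh enters only through the continuity of
  each solution and its admissibility as a test function; no function is ever interpolated from one
  mesh to the next, so h does not appear. The dual norm is taken against the full H1 norm, while the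
  diffusion controls the gradient alone. This is why a multiple of the L2 norm has to be absorbed at
  each step and why Gronwall is needed even for \<open>u = 0\<close>.\<close>

section \<open>Smooth bump functions\<close>

text \<open>Dividing by powers of \<open>x\<close> makes the family closed under differentiation, up to linear combinations.\<close>

definition exp_bump :: "nat \<Rightarrow> real \<Rightarrow> real" where
  "exp_bump m x = (if x > 0 then exp (- (1 / x)) / x ^ m else 0)"

lemma exp_bump_nonneg: "0 \<le> exp_bump m x"
  by (simp add: exp_bump_def)

lemma exp_bump_0_le_1: "exp_bump 0 x \<le> 1"
  by (simp add: exp_bump_def)

lemma exp_bump_tendsto_0: "(exp_bump m \<longlongrightarrow> 0) (at_right 0)"
proof -
  have "((\<lambda>x::real. inverse x ^ m / exp (inverse x)) \<longlongrightarrow> 0) (at_right 0)"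
    by (rule filterlim_compose[OF tendsto_power_div_exp_0 filterlim_inverse_at_top_right])
  then show ?thesis
  proof (rule Lim_transform_eventually)
    show "\<forall>\<^sub>F x in at_right 0. inverse x ^ m / exp (inverse x) = exp_bump m x"
      using eventually_at_right_less[of 0]
      by eventually_elim (simp add: exp_bump_def exp_minus field_simps)
  qed
qed

lemma exp_bump_has_field_derivative:
  "(exp_bump m has_field_derivative (exp_bump (m + 2) x - real m * exp_bump (m + 1) x)) (at x)"
proof -
  consider "x > 0" | "x < 0" | "x = 0" by linarith
  then show ?thesis
  proof cases
    case 1
    \<comment> \<open>\<open>m - Suc 0\<close> is truncated at \<open>m = 0\<close>; the factor
      \<open>real m\<close> vanishes there, so the formula holds for every \<open>m\<close>.\<close>
    have p: "real m * x ^ (m - Suc 0) = real m * x ^ m / x"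
      using 1 by (cases m) auto
    have "((\<lambda>x. exp (- (1 / x)) / x ^ m) has_field_derivative
        ((exp (- (1 / x)) * (1 / (x * x))) * x ^ m - exp (- (1 / x)) * (real m * x ^ (m - Suc 0)))
          / (x ^ m * x ^ m)) (at x)"
    proof -
      have "((\<lambda>x::real. exp (- (1 / x))) has_field_derivative exp (- (1 / x)) * (1 / (x * x))) (at x)"
        by (rule derivative_eq_intros refl)+ (use 1 in auto)
      from DERIV_divide[OF this DERIV_pow[of m x]] show ?thesis using 1 by simp
    qed
    also have "((exp (- (1 / x)) * (1 / (x * x))) * x ^ m - exp (- (1 / x)) * (real m * x ^ (m - Suc 0)))
          / (x ^ m * x ^ m) = exp_bump (m + 2) x - real m * exp_bump (m + 1) x"
      unfolding p using 1 by (simp add: exp_bump_def field_simps)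
    finally have "((\<lambda>x. exp (- (1 / x)) / x ^ m) has_field_derivative
        (exp_bump (m + 2) x - real m * exp_bump (m + 1) x)) (at x)" .
    then show ?thesis
      by (rule DERIV_cong_ev[THEN iffD1, rotated -1])
        (use 1 eventually_gt_at_top order_tendstoD[OF tendsto_ident_at] in
          \<open>auto simp: exp_bump_def intro!: eventually_mono[OF eventually_nhds_in_open[of "{0<..}" x]]\<close>)
  next
    case 2
    have "((\<lambda>_. 0) has_field_derivative (exp_bump (m + 2) x - real m * exp_bump (m + 1) x)) (at x)"
      using 2 by (simp add: exp_bump_def)
    then show ?thesis
      by (rule DERIV_cong_ev[THEN iffD1, rotated -1])
        (use 2 in \<open>auto simp: exp_bump_def intro!: eventually_mono[OF eventually_nhds_in_open[of "{..<0}" x]]\<close>)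
  next
    case 3
    \<comment> \<open>As \<open>exp_bump m 0 = 0\<close>, this is the difference quotient at 0. On
      the right it is the next member \<open>exp_bump (Suc m)\<close> of the family, on the left it
      is 0.\<close>
    have "((\<lambda>h. exp_bump m h / h) \<longlongrightarrow> 0) (at 0)"
      unfolding filterlim_split_at
    proof (rule filterlim_split_at)
      show "((\<lambda>h. exp_bump m h / h) \<longlongrightarrow> 0) (at_left 0)"
        by (rule Lim_transform_eventually[OF tendsto_const])
          (auto simp: exp_bump_def eventually_at_filter)
      show "((\<lambda>h. exp_bump m h / h) \<longlongrightarrow> 0) (at_right 0)"
        by (rule Lim_transform_eventually[OF exp_bump_tendsto_0[of "Suc m"]])
          (auto simp: exp_bump_def eventually_at_filter field_simps)
    qed
    then show ?thesis using 3
      by (simp add: has_field_derivative_iff exp_bump_def)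
  qed
qed

lemma exp_bump_0_has_field_derivative: "(exp_bump 0 has_field_derivative exp_bump 2 x) (at x)"
  using exp_bump_has_field_derivative[of 0 x] by (simp add: numeral_2_eq_2)

text \<open>Gives smoothness without formulas for higher derivatives: the class is stable under
  \<open>deriv\<close> and all members are differentiable. Affine arguments and products are there
  for the interval bumps, constants and sums for the derivative formulas.\<close>

inductive bump_generated :: "(real \<Rightarrow> real) \<Rightarrow> bool" where
  bump: "bump_generated (\<lambda>x. exp_bump m (\<alpha> * x + \<beta>))"
| const: "bump_generated (\<lambda>_. c)"
| add: "bump_generated f \<Longrightarrow> bump_generated g \<Longrightarrow> bump_generated (\<lambda>x. f x + g x)"
| mult: "bump_generated f \<Longrightarrow> bump_generated g \<Longrightarrow> bump_generated (\<lambda>x. f x * g x)"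

lemma bump_generated_has_field_derivative:
  assumes "bump_generated f"
  shows "\<exists>g. bump_generated g \<and> (\<forall>x. (f has_field_derivative g x) (at x))"
  using assms
proof induction
  case (bump m \<alpha> \<beta>)
  let ?g = "\<lambda>x. (exp_bump (m + 2) (\<alpha> * x + \<beta>) + (- real m) * exp_bump (m + 1) (\<alpha> * x + \<beta>)) * \<alpha>"
  have "((\<lambda>x. exp_bump m (\<alpha> * x + \<beta>)) has_field_derivative ?g x) (at x)" for x
    using exp_bump_has_field_derivative[of m "\<alpha> * x + \<beta>"]
    by (intro DERIV_chain2[where f="exp_bump m"]) (auto intro!: derivative_eq_intros)
  moreover have "bump_generated ?g"
    by (intro bump_generated.intros)
  ultimately show ?case by blast
next
  case (const c)
  then show ?case by (intro exI[of _ "\<lambda>_. 0"]) (auto intro: bump_generated.intros)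
next
  case (add f g)
  then obtain f' g' where *: "bump_generated f'" "\<forall>x. (f has_field_derivative f' x) (at x)"
    "bump_generated g'" "\<forall>x. (g has_field_derivative g' x) (at x)" by blast
  then show ?case
    by (intro exI[of _ "\<lambda>x. f' x + g' x"] conjI bump_generated.add allI DERIV_add) auto
next
  case (mult f g)
  then obtain f' g' where *: "bump_generated f'" "\<forall>x. (f has_field_derivative f' x) (at x)"
    "bump_generated g'" "\<forall>x. (g has_field_derivative g' x) (at x)" by blast
  then show ?case using mult.hyps
    by (intro exI[of _ "\<lambda>x. f' x * g x + g' x * f x"] conjI bump_generated.add
        bump_generated.mult allI DERIV_mult) auto
qed

lemma bump_generated_deriv:
  assumes "bump_generated f"
  shows "bump_generated (deriv f)"
proof -
  obtain g where "bump_generated g" and g: "\<And>x. (f has_field_derivative g x) (at x)"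
    using bump_generated_has_field_derivative[OF assms] by blast
  moreover have "deriv f = g" using g by (intro ext DERIV_imp_deriv)
  ultimately show ?thesis by simp
qed

lemma bump_generated_smooth: "bump_generated f \<Longrightarrow> (deriv ^^ k) f differentiable_on UNIV"
proof -
  assume "bump_generated f"
  then have "bump_generated ((deriv ^^ k) f)"
    by (induction k) (auto intro: bump_generated_deriv)
  then show ?thesis
    using bump_generated_has_field_derivative real_differentiable_def
    by (fastforce simp: differentiable_on_def)
qed

text \<open>\<open>exp_bump 0\<close> climbs from 0 to 1 on the positive half line, so each factor
  is a layer of width of order \<open>1 / Suc k\<close> inside one endpoint. \<open>Suc k\<close>
  excludes the degenerate scaling 0.\<close>

definition interval_bump :: "real \<Rightarrow> real \<Rightarrow> nat \<Rightarrow> real \<Rightarrow> real" where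
  "interval_bump c d k x = exp_bump 0 (real (Suc k) * (x - c)) * exp_bump 0 (real (Suc k) * (d - x))"

lemma interval_bump_bounds: "0 \<le> interval_bump c d k x" "interval_bump c d k x \<le> 1"
  by (auto simp: interval_bump_def exp_bump_nonneg exp_bump_0_le_1 intro!: mult_le_one)

text \<open>Written so that each term is a kernel concentrating at one endpoint times the factor of
  the other endpoint, which tends to 1 there.\<close>

lemma interval_bump_has_derivative:
  "(interval_bump c d k has_field_derivative
     real (Suc k) * exp_bump 2 (real (Suc k) * (x - c)) * exp_bump 0 (real (Suc k) * (d - x))
     - real (Suc k) * exp_bump 2 (real (Suc k) * (d - x)) * exp_bump 0 (real (Suc k) * (x - c))) (at x)"
proof -
  have "((\<lambda>x. exp_bump 0 (real (Suc k) * (x - c))) has_field_derivative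
      exp_bump 2 (real (Suc k) * (x - c)) * real (Suc k)) (at x)"
    by (rule DERIV_chain2[OF exp_bump_0_has_field_derivative]) (auto intro!: derivative_eq_intros)
  moreover have "((\<lambda>x. exp_bump 0 (real (Suc k) * (d - x))) has_field_derivative
      exp_bump 2 (real (Suc k) * (d - x)) * (- real (Suc k))) (at x)"
    by (rule DERIV_chain2[OF exp_bump_0_has_field_derivative]) (auto intro!: derivative_eq_intros)
  ultimately show ?thesis
    unfolding interval_bump_def by (rule DERIV_cong[OF DERIV_mult]) (simp add: algebra_simps)
qed

lemma test_function_interval_bump:
  assumes "a < c" "d < b"
  shows "test_function a b (interval_bump c d k)"
  unfolding test_function_def
proof (intro conjI allI exI[of _ "{c..d}"])
  have "interval_bump c d k = (\<lambda>x. exp_bump 0 (real (Suc k) * x + (- real (Suc k) * c))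
      * exp_bump 0 ((- real (Suc k)) * x + real (Suc k) * d))"
    by (rule ext) (simp add: interval_bump_def algebra_simps)
  then have "bump_generated (interval_bump c d k)"
    by (simp only:) (intro bump_generated.intros)
  then show "(deriv ^^ n) (interval_bump c d k) differentiable_on UNIV" for n
    by (rule bump_generated_smooth)
qed (use assms in \<open>auto simp: interval_bump_def exp_bump_def zero_less_mult_iff\<close>)

text \<open>The shift \<open>z\<close> serves the endpoint limits: after blowing up around one
  endpoint, the opposite factor has argument \<open>real (Suc k) * (d - c) - y\<close>.\<close>

lemma exp_bump_0_scaled_tendsto:
  assumes "y > 0" shows "(\<lambda>k. exp_bump 0 (real (Suc k) * y + z)) \<longlonglongrightarrow> 1"
proof -
  have "filterlim (\<lambda>k. real (Suc k) * y + z) at_top sequentially"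
    using assms by real_asymp
  then have ev: "\<forall>\<^sub>F k in sequentially. real (Suc k) * y + z > 0"
    by (simp add: filterlim_at_top_dense)
  have "(\<lambda>k. exp (- (1 / (real (Suc k) * y + z)))) \<longlonglongrightarrow> 1"
    using assms by real_asymp
  then show ?thesis
    by (rule Lim_transform_eventually) (use ev in \<open>eventually_elim, simp add: exp_bump_def\<close>)
qed

lemma interval_bump_tendsto: "(\<lambda>k. interval_bump c d k x) \<longlonglongrightarrow> indicator {c<..<d} x"
proof (cases "c < x \<and> x < d")
  case True
  have "(\<lambda>k. interval_bump c d k x) \<longlonglongrightarrow> 1 * 1"
    unfolding interval_bump_def
    using exp_bump_0_scaled_tendsto[of "x - c" 0] exp_bump_0_scaled_tendsto[of "d - x" 0] True
    by (intro tendsto_mult) auto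
  then show ?thesis using True by simp
next
  case False
  then have "interval_bump c d k x = 0" for k
    by (auto simp: interval_bump_def exp_bump_def zero_less_mult_iff)
  then show ?thesis using False by auto
qed

section \<open>Concentration of the kernels at a point\<close>

lemma exp_bump_measurable[measurable]: "exp_bump m \<in> borel_measurable borel"
  unfolding exp_bump_def by measurable

lemma interval_bump_measurable[measurable]: "interval_bump c d k \<in> borel_measurable borel"
  unfolding interval_bump_def by measurable

text \<open>\<open>exp_bump 2\<close> is the derivative of \<open>exp_bump 0\<close>, whose total
  increase from 0 to infinity is 1; it is a probability density on the positive half line.\<close>

lemma exp_bump_2_integral:
  "integrable lborel (exp_bump 2)" "integral\<^sup>L lborel (exp_bump 2) = 1"
proof -
  have lim: "(exp_bump 0 \<longlongrightarrow> 1) at_top"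
  proof (rule Lim_transform_eventually)
    show "((\<lambda>x::real. exp (- (1 / x))) \<longlongrightarrow> 1) at_top" by real_asymp
    show "\<forall>\<^sub>F x in at_top. exp (- (1 / x)) = exp_bump 0 x"
      using eventually_gt_at_top[of 0] by eventually_elim (simp add: exp_bump_def)
  qed
  have "(\<integral>\<^sup>+x. ennreal (exp_bump 2 x) * indicator {0..} x \<partial>lborel) = ennreal (1 - exp_bump 0 0)"
    by (rule nn_integral_FTC_atLeast) (auto intro: exp_bump_0_has_field_derivative exp_bump_nonneg lim)
  also have "(\<integral>\<^sup>+x. ennreal (exp_bump 2 x) * indicator {0..} x \<partial>lborel) = (\<integral>\<^sup>+x. ennreal (exp_bump 2 x) \<partial>lborel)"
    by (rule nn_integral_cong) (auto simp: exp_bump_def indicator_def)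
  finally have nn: "(\<integral>\<^sup>+x. ennreal (exp_bump 2 x) \<partial>lborel) = ennreal 1"
    by (simp add: exp_bump_def)
  have "has_bochner_integral lborel (exp_bump 2) 1"
    by (rule has_bochner_integral_nn_integral) (auto simp: exp_bump_nonneg nn)
  then show "integrable lborel (exp_bump 2)" "integral\<^sup>L lborel (exp_bump 2) = 1"
    by (auto simp: has_bochner_integral_iff)
qed

text \<open>The substitution \<open>x = p + s * y / real (Suc k)\<close> turns the kernel into the
  fixed density \<open>exp_bump 2\<close>, and dominated convergence applies. The kernel is
  one-sided, to the right of \<open>p\<close> for \<open>s = 1\<close> and to the left for
  \<open>s = -1\<close>, hence only \<open>y > 0\<close> matters. \<open>g\<close> may vary with
  \<open>k\<close> because it will contain the other factor of the bump.\<close>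

lemma approximate_identity:
  fixes g :: "nat \<Rightarrow> real \<Rightarrow> real"
  assumes [measurable]: "\<And>k. g k \<in> borel_measurable borel"
    and bound: "\<And>k x. \<bar>g k x\<bar> \<le> C"
    and lim: "\<And>y. y > 0 \<Longrightarrow> (\<lambda>k. g k (p + s * y / real (Suc k))) \<longlonglongrightarrow> L"
    and s: "s = 1 \<or> s = -1"
  shows "(\<lambda>k. LINT x|lborel. g k x * (real (Suc k) * exp_bump 2 (real (Suc k) * (s * (x - p))))) \<longlonglongrightarrow> L"
proof -
  have eq: "(LINT x|lborel. g k x * (real (Suc k) * exp_bump 2 (real (Suc k) * (s * (x - p)))))
     = (LINT y|lborel. g k (p + s * y / real (Suc k)) * exp_bump 2 y)" for k
  proof -
    have ss: "s * s = 1" "\<bar>s\<bar> = 1" "s \<noteq> 0" using s by auto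
    have "(LINT x|lborel. g k x * (real (Suc k) * exp_bump 2 (real (Suc k) * (s * (x - p)))))
      = \<bar>s / real (Suc k)\<bar> *\<^sub>R (LINT y|lborel. g k (p + s / real (Suc k) * y) * (real (Suc k) *
           exp_bump 2 (real (Suc k) * (s * ((p + s / real (Suc k) * y) - p)))))"
      by (rule lborel_integral_real_affine) (use ss in simp)
    also have "\<dots> = (LINT y|lborel. \<bar>s / real (Suc k)\<bar> * (g k (p + s / real (Suc k) * y) * (real (Suc k) *
           exp_bump 2 (real (Suc k) * (s * ((p + s / real (Suc k) * y) - p))))))"
      by (simp only: integral_mult_right_zero real_scaleR_def)
    also have "\<dots> = (LINT y|lborel. g k (p + s * y / real (Suc k)) * exp_bump 2 y)"
    proof (rule Bochner_Integration.integral_cong[OF refl])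
      fix y :: real
      have 1: "real (Suc k) * (s * ((p + s / real (Suc k) * y) - p)) = y"
        using ss by (simp add: field_simps del: of_nat_Suc)
      have 2: "\<bar>s / real (Suc k)\<bar> * real (Suc k) = 1" using ss by (simp del: of_nat_Suc)
      have "\<bar>s / real (Suc k)\<bar> * (g k (p + s / real (Suc k) * y) * (real (Suc k) * exp_bump 2 y))
        = (\<bar>s / real (Suc k)\<bar> * real (Suc k)) * (g k (p + s / real (Suc k) * y) * exp_bump 2 y)" by algebra
      then show "\<bar>s / real (Suc k)\<bar> * (g k (p + s / real (Suc k) * y) * (real (Suc k) *
           exp_bump 2 (real (Suc k) * (s * ((p + s / real (Suc k) * y) - p)))))
         = g k (p + s * y / real (Suc k)) * exp_bump 2 y"
        unfolding 1 2 by simp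
    qed
    finally show ?thesis .
  qed
  have "(\<lambda>k. LINT y|lborel. g k (p + s * y / real (Suc k)) * exp_bump 2 y) \<longlonglongrightarrow> (LINT y|lborel. L * exp_bump 2 y)"
  proof (rule integral_dominated_convergence[where w="\<lambda>y. C * exp_bump 2 y"])
    show "AE y in lborel. (\<lambda>k. g k (p + s * y / real (Suc k)) * exp_bump 2 y) \<longlonglongrightarrow> L * exp_bump 2 y"
    proof (intro AE_I2)
      fix y :: real show "(\<lambda>k. g k (p + s * y / real (Suc k)) * exp_bump 2 y) \<longlonglongrightarrow> L * exp_bump 2 y"
      proof (cases "y > 0")
        case True
        show ?thesis by (rule tendsto_mult[OF lim[OF True] tendsto_const])
      qed (simp add: exp_bump_def)
    qed
    show "AE y in lborel. norm (g k (p + s * y / real (Suc k)) * exp_bump 2 y) \<le> C * exp_bump 2 y" for k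
      by (intro AE_I2) (simp add: abs_mult exp_bump_nonneg mult_right_mono bound del: of_nat_Suc)
    show "integrable lborel (\<lambda>y. C * exp_bump 2 y)"
      using exp_bump_2_integral(1) by (rule integrable_mult_right)
  qed measurable
  then show ?thesis unfolding eq by (simp add: exp_bump_2_integral(2))
qed

section \<open>Weak derivatives of continuous functions\<close>

lemma integrable_mult_exp_bump_2:
  fixes g :: "real \<Rightarrow> real"
  assumes [measurable]: "g \<in> borel_measurable borel"
    and bound: "\<And>x. \<bar>g x\<bar> \<le> C"
    and s: "s = 1 \<or> s = -1"
  shows "integrable lborel (\<lambda>x. g x * (real (Suc k) * exp_bump 2 (real (Suc k) * (s * (x - p)))))"
proof (rule Bochner_Integration.integrable_bound)
  have "integrable lborel (\<lambda>x. exp_bump 2 ((- real (Suc k) * s * p) + (real (Suc k) * s) * x))"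
    by (rule lborel_integrable_real_affine) (use exp_bump_2_integral s in auto)
  then have "integrable lborel (\<lambda>x. C * (real (Suc k) * exp_bump 2 (real (Suc k) * (s * (x - p)))))"
    by (intro integrable_mult_right) (simp add: algebra_simps del: of_nat_Suc)
  then show "integrable lborel (\<lambda>x. C * (real (Suc k) * exp_bump 2 (real (Suc k) * (s * (x - p)))))" .
  show "AE x in lborel. norm (g x * (real (Suc k) * exp_bump 2 (real (Suc k) * (s * (x - p)))))
      \<le> norm (C * (real (Suc k) * exp_bump 2 (real (Suc k) * (s * (x - p)))))"
  proof (intro AE_I2)
    fix x
    have "\<bar>g x\<bar> \<le> \<bar>C\<bar>" using bound[of x] by linarith
    then show "norm (g x * (real (Suc k) * exp_bump 2 (real (Suc k) * (s * (x - p)))))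
      \<le> norm (C * (real (Suc k) * exp_bump 2 (real (Suc k) * (s * (x - p)))))"
      by (simp add: abs_mult mult_right_mono exp_bump_nonneg del: of_nat_Suc)
  qed
qed measurable

lemma Om_integral_eq_lborel:
  assumes "h \<in> borel_measurable borel"
  shows "(LINT x|Om a b. h x :: real) = (LINT x|lborel. indicator {a<..<b} x * h x)"
proof -
  have "(LINT x|Om a b. h x) = (LINT x|lebesgue. indicator {a<..<b} x *\<^sub>R h x)"
    by (rule integral_restrict_space) auto
  also have "\<dots> = (LINT x|lborel. indicator {a<..<b} x *\<^sub>R h x)"
    by (rule integral_completion) (use assms in measurable)
  finally show ?thesis by simp
qed

lemma integrable_Om_mult_bounded:
  fixes v h :: "real \<Rightarrow> real"
  assumes v: "integrable (Om a b) v" and h: "h \<in> borel_measurable (Om a b)"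
    and bd: "\<And>x. x \<in> {a<..<b} \<Longrightarrow> \<bar>h x\<bar> \<le> C"
  shows "integrable (Om a b) (\<lambda>x. v x * h x)"
proof (rule Bochner_Integration.integrable_bound)
  show "integrable (Om a b) (\<lambda>x. C * v x)" using v by (rule integrable_mult_right)
  show "(\<lambda>x. v x * h x) \<in> borel_measurable (Om a b)"
    using v h by (intro borel_measurable_times) (auto dest: borel_measurable_integrable)
  show "AE x in Om a b. norm (v x * h x) \<le> norm (C * v x)"
  proof (intro AE_I2)
    fix x assume "x \<in> space (Om a b)"
    then have "\<bar>h x\<bar> \<le> \<bar>C\<bar>" using bd[of x] by auto
    then show "norm (v x * h x) \<le> norm (C * v x)"
      by (simp add: abs_mult mult.commute mult_right_mono)
  qed
qed

lemma borel_measurable_Om: "h \<in> borel_measurable borel \<Longrightarrow> h \<in> borel_measurable (Om a b)"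
  by (simp add: measurable_completion measurable_restrict_space1)

text \<open>The strict inequalities keep the supports of the bumps inside the open interval. Along
  them the two sides of the weak identity tend to \<open>w c - w d\<close> and to minus the integral
  of \<open>v\<close> over (c,d).\<close>

lemma weak_deriv_increment_interior:
  assumes cont: "continuous_on {a..b} w" and wd: "has_weak_deriv a b w v"
    and cd: "a < c" "c < d" "d < b"
  shows "w d - w c = (LINT x|Om a b. v x * indicator {c<..<d} x)"
proof -
  \<comment> \<open>Outside [a,b] the values of \<open>w\<close> are arbitrary; the zero extension
    is bounded and Borel on the whole line, as the kernel lemmas require.\<close>
  define W where "W x = indicator {a..b} x * w x" for x
  have W_meas[measurable]: "W \<in> borel_measurable borel"
    using borel_measurable_continuous_on_indicator[OF _ cont] by (simp add: W_def[abs_def])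
  obtain C where C: "\<And>x. x \<in> {a..b} \<Longrightarrow> \<bar>w x\<bar> \<le> C"
    using compact_imp_bounded[OF compact_continuous_image[OF cont compact_Icc]]
    by (fastforce simp: bounded_iff)
  have "C \<ge> 0" using C[of c] cd by auto
  with C have W_bound: "\<bar>W x\<bar> \<le> C" for x by (auto simp: W_def indicator_def)
  have W_isCont: "isCont W p" if "a < p" "p < b" for p
  proof -
    have "isCont w p" using cont that by (simp add: continuous_on_interior)
    moreover have "\<forall>\<^sub>F x in nhds p. W x = w x"
      by (rule eventually_mono[OF eventually_nhds_in_open[of "{a<..<b}"]]) (use that in \<open>auto simp: W_def\<close>)
    ultimately show ?thesis using isCont_cong by blast
  qed
  have W_lim: "(\<lambda>k. W (p + s * y / real (Suc k))) \<longlonglongrightarrow> w p" if "a < p" "p < b" for p s y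
  proof -
    have "(\<lambda>k. p + s * y / real (Suc k)) \<longlonglongrightarrow> p" by real_asymp
    from isCont_tendsto_compose[OF W_isCont[OF that] this] show ?thesis
      using that by (simp add: W_def)
  qed
  define \<eta> where "\<eta> = interval_bump c d"
  \<comment> \<open>\<open>g1\<close> and \<open>g2\<close> combine \<open>W\<close> with the factor
    of the bump that is not differentiated.\<close>
  define g1 where "g1 k x = W x * exp_bump 0 (real (Suc k) * (d - x))" for k x
  define g2 where "g2 k x = W x * exp_bump 0 (real (Suc k) * (x - c))" for k x
  have g_meas[measurable]: "g1 k \<in> borel_measurable borel" "g2 k \<in> borel_measurable borel" for k
    unfolding g1_def g2_def by measurable
  have bd: "\<bar>W x * exp_bump 0 z\<bar> \<le> C" for x z
    using mult_mono[OF W_bound[of x] exp_bump_0_le_1[of z]] exp_bump_nonneg[of 0 z] \<open>C \<ge> 0\<close>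
    by (simp add: abs_mult)
  let ?I1 = "\<lambda>k x. g1 k x * (real (Suc k) * exp_bump 2 (real (Suc k) * (1 * (x - c))))"
  let ?I2 = "\<lambda>k x. g2 k x * (real (Suc k) * exp_bump 2 (real (Suc k) * (- 1 * (x - d))))"
  have deriv_eq: "deriv (\<eta> k) x = real (Suc k) * exp_bump 2 (real (Suc k) * (x - c)) * exp_bump 0 (real (Suc k) * (d - x))
     - real (Suc k) * exp_bump 2 (real (Suc k) * (d - x)) * exp_bump 0 (real (Suc k) * (x - c))" for k x
    unfolding \<eta>_def by (rule DERIV_imp_deriv[OF interval_bump_has_derivative])
  have lhs: "(LINT x|Om a b. w x * deriv (\<eta> k) x) = (LINT x|lborel. ?I1 k x) - (LINT x|lborel. ?I2 k x)" for k
  proof -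
    have "(LINT x|Om a b. w x * deriv (\<eta> k) x) = (LINT x|Om a b. ?I1 k x - ?I2 k x)"
    proof (rule Bochner_Integration.integral_cong[OF refl])
      fix x assume "x \<in> space (Om a b)"
      then have "W x = w x" by (simp add: W_def)
      moreover have "- 1 * (x - d) = d - x" "1 * (x - c) = x - c" by auto
      ultimately show "w x * deriv (\<eta> k) x = ?I1 k x - ?I2 k x"
        unfolding deriv_eq g1_def g2_def by (simp only: right_diff_distrib mult_ac)
    qed
    also have "\<dots> = (LINT x|lborel. indicator {a<..<b} x * (?I1 k x - ?I2 k x))"
      by (rule Om_integral_eq_lborel) measurable
    also have "\<dots> = (LINT x|lborel. ?I1 k x - ?I2 k x)"
    proof (rule Bochner_Integration.integral_cong[OF refl])
      fix x
      show "indicator {a<..<b} x * (?I1 k x - ?I2 k x) = ?I1 k x - ?I2 k x"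
      proof (cases "x \<in> {a<..<b}")
        case False
        \<comment> \<open>Both terms still contain a factor from each endpoint, so they vanish
          outside (c,d) and the integral extends to the whole line.\<close>
        then have "x \<le> c \<or> d \<le> x" using cd by auto
        then have "?I1 k x = 0" "?I2 k x = 0"
          by (auto simp: g1_def g2_def exp_bump_def zero_less_mult_iff simp del: of_nat_Suc)
        then show ?thesis by (simp only: diff_self mult_zero_right)
      qed simp
    qed
    also have "\<dots> = (LINT x|lborel. ?I1 k x) - (LINT x|lborel. ?I2 k x)"
    proof (rule Bochner_Integration.integral_diff)
      show "integrable lborel (?I1 k)"
        by (rule integrable_mult_exp_bump_2[of _ C]) (auto simp: g1_def[abs_def] bd)
      show "integrable lborel (?I2 k)"
        by (rule integrable_mult_exp_bump_2[of _ C]) (auto simp: g2_def[abs_def] bd)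
    qed
    finally show ?thesis .
  qed
  have lim1: "(\<lambda>k. LINT x|lborel. ?I1 k x) \<longlonglongrightarrow> w c"
  proof (rule approximate_identity[where C=C])
    fix y :: real assume "y > 0"
    have "(\<lambda>k. W (c + 1 * y / real (Suc k)) * exp_bump 0 (real (Suc k) * (d - c) + (- y))) \<longlonglongrightarrow> w c * 1"
      by (intro tendsto_mult W_lim exp_bump_0_scaled_tendsto) (use cd in auto)
    moreover have "real (Suc k) * (d - c) + - y = real (Suc k) * (d - (c + 1 * y / real (Suc k)))" for k
      by (simp add: field_simps del: of_nat_Suc)
    ultimately show "(\<lambda>k. g1 k (c + 1 * y / real (Suc k))) \<longlonglongrightarrow> w c"
      by (simp only: g1_def mult_1_right)
  qed (auto simp: g1_def bd)
  have lim2: "(\<lambda>k. LINT x|lborel. ?I2 k x) \<longlonglongrightarrow> w d"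
  proof (rule approximate_identity[where C=C])
    fix y :: real assume "y > 0"
    have "(\<lambda>k. W (d + - 1 * y / real (Suc k)) * exp_bump 0 (real (Suc k) * (d - c) + (- y))) \<longlonglongrightarrow> w d * 1"
      by (intro tendsto_mult W_lim exp_bump_0_scaled_tendsto) (use cd in auto)
    moreover have "real (Suc k) * (d - c) + - y = real (Suc k) * ((d + - 1 * y / real (Suc k)) - c)" for k
      by (simp add: field_simps del: of_nat_Suc)
    ultimately show "(\<lambda>k. g2 k (d + - 1 * y / real (Suc k))) \<longlonglongrightarrow> w d"
      by (simp only: g2_def mult_1_right)
  qed (auto simp: g2_def bd)
  have v: "integrable (Om a b) v" using wd by (simp add: has_weak_deriv_def)
  have rhs: "(\<lambda>k. LINT x|Om a b. v x * \<eta> k x) \<longlonglongrightarrow> (LINT x|Om a b. v x * indicator {c<..<d} x)"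
  proof (rule integral_dominated_convergence[where w="\<lambda>x. \<bar>v x\<bar>"])
    show "(\<lambda>x. v x * \<eta> k x) \<in> borel_measurable (Om a b)" for k
      unfolding \<eta>_def
      by (intro borel_measurable_times[OF borel_measurable_integrable[OF v]] borel_measurable_Om) measurable
    show "(\<lambda>x. v x * indicator {c<..<d} x) \<in> borel_measurable (Om a b)"
      by (intro borel_measurable_times[OF borel_measurable_integrable[OF v]] borel_measurable_Om) measurable
    show "integrable (Om a b) (\<lambda>x. \<bar>v x\<bar>)" using v by simp
    show "AE x in Om a b. (\<lambda>k. v x * \<eta> k x) \<longlonglongrightarrow> v x * indicator {c<..<d} x"
      unfolding \<eta>_def by (intro AE_I2 tendsto_mult tendsto_const interval_bump_tendsto)
    show "AE x in Om a b. norm (v x * \<eta> k x) \<le> \<bar>v x\<bar>" for k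
      using interval_bump_bounds[of c d k] unfolding \<eta>_def
      by (intro AE_I2) (auto simp: abs_mult intro: mult_left_le)
  qed
  have "(\<lambda>k. LINT x|Om a b. w x * deriv (\<eta> k) x) \<longlonglongrightarrow> w c - w d"
    unfolding lhs by (intro tendsto_diff lim1 lim2)
  moreover have "(LINT x|Om a b. w x * deriv (\<eta> k) x) = - (LINT x|Om a b. v x * \<eta> k x)" for k
    using wd test_function_interval_bump[of a c d b k] cd by (simp add: has_weak_deriv_def \<eta>_def)
  ultimately have "(\<lambda>k. - (LINT x|Om a b. v x * \<eta> k x)) \<longlonglongrightarrow> w c - w d" by simp
  from LIMSEQ_unique[OF this tendsto_minus[OF rhs]] show ?thesis by simp
qed

text \<open>The interior formula on slightly smaller intervals passes to the limit, by dominated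
  convergence and by continuity of \<open>w\<close> up to the boundary. The gauge integral form
  suits the later comparisons and splittings on subintervals.\<close>

theorem weak_deriv_has_integral:
  assumes cont: "continuous_on {a..b} w" and wd: "has_weak_deriv a b w v"
    and cd: "a \<le> c" "c \<le> d" "d \<le> b"
  shows "(v has_integral (w d - w c)) {c..d}"
proof (cases "c = d")
  case False
  then have "c < d" using cd by simp
  have v: "integrable (Om a b) v" using wd by (simp add: has_weak_deriv_def)
  \<comment> \<open>With the offset 3 each end moves by at most a third of the length: the intervals
    stay nonempty, and their ends are interior even if \<open>c = a\<close> or
    \<open>d = b\<close>.\<close>
  define c' where "c' k = c + (d - c) / real (k + 3)" for k :: nat
  define d' where "d' k = d - (d - c) / real (k + 3)" for k :: nat
  have pos: "0 < (d - c) / real (k + 3)" "(d - c) / real (k + 3) < (d - c) / 2" for k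
    using \<open>c < d\<close> divide_strict_left_mono[of 2 "real (k + 3)" "d - c"] by (auto simp del: of_nat_add)
  have c': "c < c' k" "c' k < d' k" "d' k < d" for k
  proof -
    obtain e where e: "e = (d - c) / real (k + 3)" by blast
    have "0 < e" "e < (d - c) / 2" using pos[of k] unfolding e by blast+
    then show "c < c' k" "c' k < d' k" "d' k < d"
      unfolding c'_def d'_def e[symmetric] by (simp_all add: field_simps)
  qed
  have lim: "c' \<longlonglongrightarrow> c" "d' \<longlonglongrightarrow> d"
    unfolding c'_def d'_def by real_asymp+
  have "(\<lambda>k. LINT x|Om a b. v x * indicator {c' k<..<d' k} x) \<longlonglongrightarrow> (LINT x|Om a b. v x * indicator {c<..<d} x)"
  proof (rule integral_dominated_convergence[where w="\<lambda>x. \<bar>v x\<bar>"])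
    show "(\<lambda>x. v x * indicator {c' k<..<d' k} x) \<in> borel_measurable (Om a b)" for k
      by (intro borel_measurable_times[OF borel_measurable_integrable[OF v]] borel_measurable_Om) measurable
    show "(\<lambda>x. v x * indicator {c<..<d} x) \<in> borel_measurable (Om a b)"
      by (intro borel_measurable_times[OF borel_measurable_integrable[OF v]] borel_measurable_Om) measurable
    show "integrable (Om a b) (\<lambda>x. \<bar>v x\<bar>)" using v by simp
    show "AE x in Om a b. (\<lambda>k. v x * indicator {c' k<..<d' k} x) \<longlonglongrightarrow> v x * indicator {c<..<d} x"
    proof (intro AE_I2 tendsto_mult tendsto_const)
      fix x
      show "(\<lambda>k. indicator {c' k<..<d' k} x) \<longlonglongrightarrow> (indicator {c<..<d} x :: real)"
      proof (cases "c < x \<and> x < d")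
        case True
        then have "\<forall>\<^sub>F k in sequentially. c' k < x" "\<forall>\<^sub>F k in sequentially. x < d' k"
          using lim order_tendstoD by blast+
        then have "\<forall>\<^sub>F k in sequentially. indicator {c<..<d} x = (indicator {c' k<..<d' k} x :: real)"
          by eventually_elim (use True in simp)
        then show ?thesis by (rule Lim_transform_eventually[OF tendsto_const])
      next
        case False
        then have "indicator {c' k<..<d' k} x = (indicator {c<..<d} x :: real)" for k
          using c'[of k] by (auto simp: indicator_def)
        then show ?thesis by simp
      qed
    qed
    show "AE x in Om a b. norm (v x * indicator {c' k<..<d' k} x) \<le> \<bar>v x\<bar>" for k
      by (intro AE_I2) (auto simp: indicator_def)
  qed
  moreover have "(LINT x|Om a b. v x * indicator {c' k<..<d' k} x) = w (d' k) - w (c' k)" for k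
    using weak_deriv_increment_interior[OF cont wd, of "c' k" "d' k"] c'[of k] cd by simp
  moreover have "(\<lambda>k. w (d' k) - w (c' k)) \<longlonglongrightarrow> w d - w c"
  proof (intro tendsto_diff)
    have "c' k \<in> {a..b}" "d' k \<in> {a..b}" for k using c'[of k] cd by auto
    then show "(\<lambda>k. w (d' k)) \<longlonglongrightarrow> w d" "(\<lambda>k. w (c' k)) \<longlonglongrightarrow> w c"
      using cd by (auto intro!: continuous_on_tendsto_compose[OF cont] lim)
  qed
  ultimately have eq: "(LINT x|Om a b. v x * indicator {c<..<d} x) = w d - w c"
    using LIMSEQ_unique by simp
  have "integrable (Om a b) (\<lambda>x. v x * indicator {c<..<d} x)"
    using v by (rule integrable_Om_mult_bounded[where C=1]) (auto intro: borel_measurable_Om simp: indicator_def)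
  from has_integral_integral_lebesgue_on[OF this]
  have "((\<lambda>x. v x * indicator {c<..<d} x) has_integral (w d - w c)) {a<..<b}" by (simp add: eq)
  then have "((\<lambda>x. if x \<in> {a<..<b} then v x * indicator {c<..<d} x else 0) has_integral (w d - w c)) UNIV"
    by (simp only: has_integral_restrict_UNIV)
  moreover have "(\<lambda>x. if x \<in> {a<..<b} then v x * indicator {c<..<d} x else 0) = (\<lambda>x. if x \<in> {c<..<d} then v x else 0)"
    using cd by (auto simp: indicator_def fun_eq_iff)
  ultimately have "(v has_integral (w d - w c)) {c<..<d}"
    by (simp only: has_integral_restrict_UNIV)
  then show ?thesis
    using has_integral_Icc_iff_Ioo by blast
qed (use has_integral_refl in auto)

lemma integrable_Om_has_integral:
  fixes f :: "real \<Rightarrow> real"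
  assumes "integrable (Om a b) f"
  shows "(f has_integral (LINT x|Om a b. f x)) {a..b}"
  using has_integral_integral_lebesgue_on[OF assms] has_integral_Icc_iff_Ioo by auto

lemma integrable_Om_continuous:
  fixes w :: "real \<Rightarrow> real"
  assumes "continuous_on {a..b} w"
  shows "integrable (Om a b) w"
proof -
  obtain C where C: "\<And>x. x \<in> {a..b} \<Longrightarrow> \<bar>w x\<bar> \<le> C"
    using compact_imp_bounded[OF compact_continuous_image[OF assms compact_Icc]]
    by (fastforce simp: bounded_iff)
  have "integrable (Om a b) (\<lambda>x. 1 * w x)"
  proof (rule integrable_Om_mult_bounded[where C=C])
    show "integrable (Om a b) (\<lambda>x. 1 :: real)"
      by (rule finite_measure.integrable_const[OF finite_measure_lebesgue_on]) simp
    show "w \<in> borel_measurable (Om a b)"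
      by (rule continuous_imp_measurable_on_sets_lebesgue) (auto intro: continuous_on_subset[OF assms])
  qed (use C in auto)
  then show ?thesis by simp
qed

section \<open>Uniqueness of the weak derivative\<close>

text \<open>The positive and the negative part of \<open>g\<close> are densities of two measures
  that agree on all half lines, hence everywhere. So the two parts agree almost everywhere, which
  forces both to be 0.\<close>

lemma AE_zero_if_integral_greaterThan_zero:
  fixes g :: "real \<Rightarrow> real"
  assumes g: "integrable lborel g"
    and zero: "\<And>t. (LINT x|lborel. g x * indicator {t<..} x) = 0"
  shows "AE x in lborel. g x = 0"
proof -
  note [measurable] = borel_measurable_integrable[OF g]
  have int: "integrable lborel (\<lambda>x. g x * indicator {t<..} x)" for t
    by (rule integrable_real_mult_indicator[OF _ g]) simp
  have em: "emeasure (density lborel (\<lambda>x. ennreal (s * g x))) {t<..} = (\<integral>\<^sup>+x. ennreal (s * (g x * indicator {t<..} x)) \<partial>lborel)" for s t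
    by (subst emeasure_density) (auto intro!: nn_integral_cong simp: indicator_def)
  have fin: "(\<integral>\<^sup>+x. ennreal (s * (g x * indicator {t<..} x)) \<partial>lborel) < \<infinity>" if "s = 1 \<or> s = - 1" for s t
    using int[of t] that by (auto simp: real_integrable_def less_top[symmetric])
  \<comment> \<open>\<open>ennreal\<close> sends negative numbers to 0, so these densities are the
    two parts of \<open>g\<close>. The factors \<open>1\<close> and \<open>- 1\<close> make both
    sides instances of \<open>em\<close> and \<open>fin\<close>.\<close>
  have "density lborel (\<lambda>x. ennreal (1 * g x)) = density lborel (\<lambda>x. ennreal ((- 1) * g x))"
  proof (rule measure_eqI_lessThan)
    fix t
    show "emeasure (density lborel (\<lambda>x. ennreal (1 * g x))) {t<..} < \<infinity>"
      unfolding em by (rule fin) simp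
    have "enn2real (\<integral>\<^sup>+x. ennreal (1 * (g x * indicator {t<..} x)) \<partial>lborel)
        = enn2real (\<integral>\<^sup>+x. ennreal ((-1) * (g x * indicator {t<..} x)) \<partial>lborel)"
      using real_lebesgue_integral_def[OF int[of t]] zero[of t] by simp
    then show "emeasure (density lborel (\<lambda>x. ennreal (1 * g x))) {t<..} = emeasure (density lborel (\<lambda>x. ennreal ((- 1) * g x))) {t<..}"
      unfolding em
      using ennreal_enn2real[OF fin[of 1 t, unfolded infinity_ennreal_def]]
        ennreal_enn2real[OF fin[of "- 1" t, unfolded infinity_ennreal_def]]
      by (auto simp del: mult_1_left mult_minus1)
  qed auto
  then have "AE x in lborel. ennreal (1 * g x) = ennreal ((- 1) * g x)"
    by (intro sigma_finite_measure.density_unique[OF sigma_finite_lborel]) auto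
  then show ?thesis
  proof eventually_elim
    case (elim x)
    then show ?case by (cases "g x \<ge> 0") (auto simp: ennreal_neg ennreal_eq_0_iff)
  qed
qed

text \<open>The density argument lives on \<open>lborel\<close>, whereas \<open>f\<close> is only
  Lebesgue measurable; its zero extension is therefore exchanged for a Borel function. Integrals
  over half lines then reduce to integrals over \<open>{max a t..b}\<close>.\<close>

lemma AE_zero_if_interval_integrals_zero:
  fixes f :: "real \<Rightarrow> real"
  assumes f: "integrable (Om a b) f"
    and zero: "\<And>c. a \<le> c \<Longrightarrow> c \<le> b \<Longrightarrow> (f has_integral 0) {c..b}"
  shows "AE x in Om a b. f x = 0"
proof -
  define F where "F x = indicator {a<..<b} x * f x" for x
  have F: "integrable lebesgue F"
    using f by (simp add: integrable_restrict_space F_def[abs_def])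
  then obtain g where g[measurable]: "g \<in> borel_measurable lborel" and Fg: "AE x in lborel. F x = g x"
    using completion_ex_borel_measurable_real[OF borel_measurable_integrable[OF F]] by blast
  from Fg have Fg': "AE x in lebesgue. F x = g x" by (rule AE_completion)
  have g': "g \<in> borel_measurable lebesgue" using g by (rule measurable_completion)
  have "integrable lebesgue g"
    using F integrable_cong_AE[OF borel_measurable_integrable[OF F] g' Fg'] by blast
  then have gi: "integrable lborel g" by (simp add: integrable_completion)
  have "AE x in lborel. g x = 0"
  proof (rule AE_zero_if_integral_greaterThan_zero[OF gi])
    fix t
    let ?h = "\<lambda>x. f x * indicator {t<..} x"
    have "(LINT x|lborel. g x * indicator {t<..} x) = (LINT x|lebesgue. g x * indicator {t<..} x)"
      by (rule integral_completion[symmetric]) simp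
    also have "\<dots> = (LINT x|lebesgue. F x * indicator {t<..} x)"
    proof (rule integral_cong_AE)
      have ind: "(indicator {t<..} :: real \<Rightarrow> real) \<in> borel_measurable lebesgue"
        by (rule measurable_completion) simp
      show "(\<lambda>x. g x * indicator {t<..} x) \<in> borel_measurable lebesgue"
        by (rule borel_measurable_times[OF g' ind])
      show "(\<lambda>x. F x * indicator {t<..} x) \<in> borel_measurable lebesgue"
        by (rule borel_measurable_times[OF borel_measurable_integrable[OF F] ind])
    qed (use Fg' in auto)
    also have "\<dots> = (LINT x|Om a b. ?h x)"
      by (simp add: integral_restrict_space F_def mult.assoc)
    also have "\<dots> = 0"
    proof -
      have "integrable (Om a b) ?h"
        by (rule integrable_Om_mult_bounded[OF f, where C=1]) (auto intro: borel_measurable_Om simp: indicator_def)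
      then have 1: "(?h has_integral (LINT x|Om a b. ?h x)) {a..b}" by (rule integrable_Om_has_integral)
      have "(?h has_integral 0) {a..b}"
      proof (cases "t < b \<and> a < b")
        case True
        define c where "c = max a t"
        have "((\<lambda>x. if x \<in> {c..b} then f x else 0) has_integral 0) {a..b}"
          using zero[of c] True by (subst has_integral_restrict) (auto simp: c_def)
        then show ?thesis
          by (rule has_integral_spike[of "{c}", rotated -1]) (auto simp: c_def indicator_def)
      next
        case False
        then show ?thesis
          by (intro has_integral_spike[of "{a}" _ ?h "\<lambda>_. 0", OF _ _ has_integral_0]) (auto simp: indicator_def)
      qed
      with 1 show ?thesis by (rule has_integral_unique)
    qed
    finally show "(LINT x|lborel. g x * indicator {t<..} x) = 0" .
  qed
  with Fg have "AE x in lborel. F x = 0" by eventually_elim simp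
  then have "AE x in lebesgue. F x = 0" by (rule AE_completion)
  then show ?thesis
    by (subst AE_restrict_space_iff) (auto simp: F_def elim!: eventually_mono)
qed

text \<open>Both candidates have the same integral \<open>w b - w c\<close> over every
  \<open>{c..b}\<close>. This ties the chosen \<open>weak_deriv\<close> to any weak derivative
  computed explicitly.\<close>

lemma has_weak_deriv_unique:
  assumes cont: "continuous_on {a..b} w" and v: "has_weak_deriv a b w v" "has_weak_deriv a b w v'"
  shows "AE x in Om a b. v x = v' x"
proof -
  have "AE x in Om a b. v x - v' x = 0"
  proof (rule AE_zero_if_interval_integrals_zero)
    show "integrable (Om a b) (\<lambda>x. v x - v' x)" using v by (simp add: has_weak_deriv_def)
    show "((\<lambda>x. v x - v' x) has_integral 0) {c..b}" if "a \<le> c" "c \<le> b" for c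
      using has_integral_diff[OF weak_deriv_has_integral[OF cont v(1)] weak_deriv_has_integral[OF cont v(2)], of c b] that
      by simp
  qed
  then show ?thesis by simp
qed

lemma has_weak_deriv_weak_deriv:
  "has_weak_deriv a b w v \<Longrightarrow> has_weak_deriv a b w (weak_deriv a b w)"
  unfolding weak_deriv_def by (rule someI[where P="has_weak_deriv a b w"])

lemma weak_deriv_AE_eq:
  "continuous_on {a..b} w \<Longrightarrow> has_weak_deriv a b w v \<Longrightarrow> AE x in Om a b. weak_deriv a b w x = v x"
  using has_weak_deriv_unique has_weak_deriv_weak_deriv by blast

section \<open>Calculus of weak derivatives\<close>

lemma has_weak_deriv_cong_AE:
  assumes "has_weak_deriv a b w v" "v' \<in> borel_measurable (Om a b)" "AE x in Om a b. v x = v' x"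
  shows "has_weak_deriv a b w v'"
  unfolding has_weak_deriv_def
proof (intro conjI allI impI)
  have v: "integrable (Om a b) v" using assms by (simp add: has_weak_deriv_def)
  then show v': "integrable (Om a b) v'"
    using assms integrable_cong_AE[OF borel_measurable_integrable[OF v] assms(2,3)] by blast
  show "integrable (Om a b) w" using assms by (simp add: has_weak_deriv_def)
  fix \<eta> assume \<eta>: "test_function a b \<eta>"
  then have "continuous_on UNIV \<eta>"
    unfolding test_function_def by (metis differentiable_imp_continuous_on funpow_0)
  then have "\<eta> \<in> borel_measurable (Om a b)"
    by (intro borel_measurable_Om borel_measurable_continuous_onI)
  then have "(LINT x|Om a b. v' x * \<eta> x) = (LINT x|Om a b. v x * \<eta> x)"
    using v v' assms(3) by (intro integral_cong_AE borel_measurable_times) auto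
  then show "(LINT x|Om a b. w x * deriv \<eta> x) = - (LINT x|Om a b. v' x * \<eta> x)"
    using assms(1) \<eta> by (simp add: has_weak_deriv_def)
qed

lemma test_functionD:
  assumes "test_function a b \<eta>"
  shows "(\<eta> has_field_derivative deriv \<eta> x) (at x)" "continuous_on A \<eta>" "continuous_on A (deriv \<eta>)"
    "\<eta> a = 0" "\<eta> b = 0"
proof -
  have 0: "\<eta> differentiable_on UNIV" "deriv \<eta> differentiable_on UNIV"
    using assms[unfolded test_function_def, THEN conjunct1, rule_format, of 0]
      assms[unfolded test_function_def, THEN conjunct1, rule_format, of 1] by simp_all
  then show "(\<eta> has_field_derivative deriv \<eta> x) (at x)"
    using DERIV_deriv_iff_real_differentiable by (auto simp: differentiable_on_def)
  show "continuous_on A \<eta>" "continuous_on A (deriv \<eta>)"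
    using 0 differentiable_imp_continuous_on continuous_on_subset by blast+
  show "\<eta> a = 0" "\<eta> b = 0" using assms by (auto simp: test_function_def)
qed

lemma integrable_Om_mult_continuous:
  fixes v h :: "real \<Rightarrow> real"
  assumes v: "integrable (Om a b) v" and h: "continuous_on {a..b} h"
  shows "integrable (Om a b) (\<lambda>x. v x * h x)"
proof -
  obtain C where C: "\<And>x. x \<in> {a..b} \<Longrightarrow> \<bar>h x\<bar> \<le> C"
    using compact_imp_bounded[OF compact_continuous_image[OF h compact_Icc]]
    by (fastforce simp: bounded_iff)
  show ?thesis
    by (rule integrable_Om_mult_bounded[OF v borel_measurable_integrable[OF integrable_Om_continuous[OF h]], of C])
      (use C in auto)
qed

lemma has_weak_deriv_lincomb:
  assumes "has_weak_deriv a b w v" "has_weak_deriv a b w' v'"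
  shows "has_weak_deriv a b (\<lambda>x. \<alpha> * w x + \<beta> * w' x) (\<lambda>x. \<alpha> * v x + \<beta> * v' x)"
  unfolding has_weak_deriv_def
proof (intro conjI allI impI)
  have i: "integrable (Om a b) w" "integrable (Om a b) w'" "integrable (Om a b) v" "integrable (Om a b) v'"
    using assms by (auto simp: has_weak_deriv_def)
  then show "integrable (Om a b) (\<lambda>x. \<alpha> * w x + \<beta> * w' x)" "integrable (Om a b) (\<lambda>x. \<alpha> * v x + \<beta> * v' x)"
    by auto
  fix \<eta> assume \<eta>: "test_function a b \<eta>"
  note c = test_functionD(2,3)[OF \<eta>, of "{a..b}"]
  have lin: "(LINT x|Om a b. (\<alpha> * f x + \<beta> * g x) * h x) = \<alpha> * (LINT x|Om a b. f x * h x) + \<beta> * (LINT x|Om a b. g x * h x)"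
    if "integrable (Om a b) f" "integrable (Om a b) g" "continuous_on {a..b} h" for f g h :: "real \<Rightarrow> real"
    using integrable_Om_mult_continuous[OF that(1,3)] integrable_Om_mult_continuous[OF that(2,3)]
    by (simp add: distrib_right mult.assoc)
  show "(LINT x|Om a b. (\<alpha> * w x + \<beta> * w' x) * deriv \<eta> x) = - (LINT x|Om a b. (\<alpha> * v x + \<beta> * v' x) * \<eta> x)"
    unfolding lin[OF i(1,2) c(2)] lin[OF i(3,4) c(1)]
    using assms \<eta> by (simp add: has_weak_deriv_def)
qed

text \<open>The fundamental theorem for \<open>w * \<eta>\<close> tolerates finitely many
  exceptional points, and the boundary terms vanish with \<eta>. Serves the identity map and the
  finite element functions.\<close>

lemma has_weak_deriv_piecewise:
  assumes "a \<le> b" "finite S" and cont: "continuous_on {a..b} w"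
    and d: "\<And>x. x \<in> {a<..<b} - S \<Longrightarrow> (w has_field_derivative v x) (at x)"
    and v: "integrable (Om a b) v"
  shows "has_weak_deriv a b w v"
  unfolding has_weak_deriv_def
proof (intro conjI allI impI)
  show w: "integrable (Om a b) w" by (rule integrable_Om_continuous[OF cont])
  show "integrable (Om a b) v" by (rule v)
  fix \<eta> assume \<eta>: "test_function a b \<eta>"
  note t = test_functionD[OF \<eta>]
  have i: "integrable (Om a b) (\<lambda>x. w x * deriv \<eta> x)" "integrable (Om a b) (\<lambda>x. v x * \<eta> x)"
    by (intro integrable_Om_mult_continuous w v t)+
  have ftc: "((\<lambda>x. w x * deriv \<eta> x + v x * \<eta> x) has_integral (w b * \<eta> b - w a * \<eta> a)) {a..b}"
  proof (rule fundamental_theorem_of_calculus_interior_strong[OF assms(2,1)])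
    fix x assume "x \<in> {a<..<b} - S"
    from DERIV_mult[OF d[OF this] t(1)[of x]]
    show "((\<lambda>x. w x * \<eta> x) has_vector_derivative (w x * deriv \<eta> x + v x * \<eta> x)) (at x)"
      by (simp add: has_real_derivative_iff_has_vector_derivative add.commute mult.commute)
  qed (intro continuous_intros cont t)
  have "((\<lambda>x. w x * deriv \<eta> x + v x * \<eta> x) has_integral
      ((LINT x|Om a b. w x * deriv \<eta> x) + (LINT x|Om a b. v x * \<eta> x))) {a..b}"
    by (intro has_integral_add integrable_Om_has_integral i)
  from has_integral_unique[OF this ftc]
  show "(LINT x|Om a b. w x * deriv \<eta> x) = - (LINT x|Om a b. v x * \<eta> x)"
    by (simp add: t(4,5))
qed

section \<open>Change of variables along a nondecreasing Lipschitz map\<close>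

lemma has_weak_deriv_bounded_increment:
  assumes cont: "continuous_on {a..b} X" and wd: "has_weak_deriv a b X \<gamma>"
    and bd: "\<And>x. 0 \<le> \<gamma> x" "\<And>x. \<gamma> x \<le> L"
    and cd: "a \<le> c" "c \<le> d" "d \<le> b"
  shows "X c \<le> X d" "X d - X c \<le> L * (d - c)"
proof -
  have i: "(\<gamma> has_integral (X d - X c)) {c..d}" by (rule weak_deriv_has_integral[OF cont wd cd])
  show "X c \<le> X d" using has_integral_nonneg[OF i] bd by simp
  have "((\<lambda>_. L) has_integral (L * (d - c))) {c..d}"
    using has_integral_const_real[of L c d] cd by (simp add: mult.commute)
  from has_integral_le[OF i this] show "X d - X c \<le> L * (d - c)"
    using bd by blast
qed

text \<open>For constant \<open>G\<close> this is the increment formula for \<open>X\<close>; a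
  continuous \<open>G\<close> is almost constant at small scales, and the errors are of higher
  order.\<close>

lemma integral_substitution_weak_deriv_bounded:
  assumes ab: "a \<le> b" and cont: "continuous_on {a..b} X" and wd: "has_weak_deriv a b X \<gamma>"
    and Xa: "X a = a" and Xb: "X b = b"
    and bd: "\<And>x. 0 \<le> \<gamma> x" "\<And>x. \<gamma> x \<le> L"
    and G: "continuous_on {a..b} G"
  shows "(LINT x|Om a b. \<gamma> x * G (X x)) = (LINT x|Om a b. G x)"
proof -
  note inc = has_weak_deriv_bounded_increment[OF cont wd bd]
  have X_in: "X x \<in> {a..b}" if "x \<in> {a..b}" for x
    using inc(1)[of a x] inc(1)[of x b] that Xa Xb by auto
  have GX: "continuous_on {a..b} (\<lambda>x. G (X x))"
    by (rule continuous_on_compose2[OF G cont]) (use X_in in auto)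
  have \<gamma>: "integrable (Om a b) \<gamma>" using wd by (simp add: has_weak_deriv_def)
  have iGX: "integrable (Om a b) (\<lambda>x. \<gamma> x * G (X x))"
    by (rule integrable_Om_mult_continuous[OF \<gamma> GX])
  have int1: "(\<lambda>x. \<gamma> x * G (X x)) integrable_on {c..d}" if "a \<le> c" "d \<le> b" for c d
    using integrable_on_subinterval[OF has_integral_integrable[OF integrable_Om_has_integral[OF iGX]], of c d] that
    by auto
  have int2: "G integrable_on {c..d}" if "a \<le> c" "d \<le> b" for c d
    by (rule integrable_continuous_interval[OF continuous_on_subset[OF G]]) (use that in auto)
  have "0 \<le> L" using bd[of a] by linarith
  txt \<open>
    The Lipschitz map \<open>X\<close> is differentiable only almost everywhere, but \<open>D\<close> is differentiable
    everywhere with derivative 0: replacing \<open>G\<close> by a constant near a point makes both integrals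
    equal to the same multiple of the increment of \<open>X\<close>.
  \<close>
  define D where "D x = integral {a..x} (\<lambda>x. \<gamma> x * G (X x)) - integral {a..X x} G" for x
  \<comment> \<open>Both integrals differ from \<open>(X d - X c) * G0\<close> by at most
    \<open>\<epsilon> * (X d - X c)\<close>: the first because \<gamma> is nonnegative with integral
    \<open>X d - X c\<close>, the second because its interval has that length.\<close>
  have D_inc: "\<bar>D d - D c\<bar> \<le> 2 * \<epsilon> * L * (d - c)"
    if cd: "a \<le> c" "c \<le> d" "d \<le> b" and \<epsilon>: "\<And>s. s \<in> {c..d} \<Longrightarrow> \<bar>G (X s) - G0\<bar> \<le> \<epsilon>" for c d \<epsilon> G0
  proof -
    note X_cd = inc[OF cd]
    have Xc: "X c \<in> {a..b}" "X d \<in> {a..b}" using X_in cd by auto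
    have "\<epsilon> \<ge> 0" using \<epsilon>[of c] cd by auto
    have 1: "integral {a..d} (\<lambda>x. \<gamma> x * G (X x)) - integral {a..c} (\<lambda>x. \<gamma> x * G (X x)) = integral {c..d} (\<lambda>x. \<gamma> x * G (X x))"
      using Henstock_Kurzweil_Integration.integral_combine[OF cd(1,2) int1[OF order_refl cd(3)]] by simp
    have 2: "integral {a..X d} G - integral {a..X c} G = integral {X c..X d} G"
      using Henstock_Kurzweil_Integration.integral_combine[of a "X c" "X d" G] X_cd Xc int2[of a "X d"] by simp
    have i: "(\<gamma> has_integral (X d - X c)) {c..d}" by (rule weak_deriv_has_integral[OF cont wd cd])
    have "((\<lambda>x. \<gamma> x * G (X x) - \<gamma> x * G0) has_integral (integral {c..d} (\<lambda>x. \<gamma> x * G (X x)) - (X d - X c) * G0)) {c..d}"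
      by (intro has_integral_diff has_integral_mult_left i integrable_integral int1 cd)
    then have A: "\<bar>integral {c..d} (\<lambda>x. \<gamma> x * G (X x)) - (X d - X c) * G0\<bar> \<le> \<epsilon> * (X d - X c)"
    proof -
      assume h: "((\<lambda>x. \<gamma> x * G (X x) - \<gamma> x * G0) has_integral (integral {c..d} (\<lambda>x. \<gamma> x * G (X x)) - (X d - X c) * G0)) {c..d}"
      have h2: "((\<lambda>x. \<epsilon> * \<gamma> x) has_integral \<epsilon> * (X d - X c)) {c..d}"
        by (rule has_integral_mult_right[OF i])
      have "norm (\<gamma> x * G (X x) - \<gamma> x * G0) \<le> \<epsilon> * \<gamma> x" if "x \<in> {c..d}" for x
        using mult_left_mono[OF \<epsilon>[OF that] bd(1)[of x]] bd(1)[of x]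
        by (simp only: right_diff_distrib[symmetric] abs_mult real_norm_def abs_of_nonneg mult.commute[of \<epsilon>])
      from integral_norm_bound_integral[OF has_integral_integrable[OF h] has_integral_integrable[OF h2] this]
      show ?thesis unfolding integral_unique[OF h] integral_unique[OF h2] by simp
    qed
    have "((\<lambda>x. G x - G0) has_integral (integral {X c..X d} G - (X d - X c) * G0)) {X c..X d}"
      using has_integral_diff[OF integrable_integral[OF int2[of "X c" "X d"]] has_integral_const_real[of G0 "X c" "X d"]] X_cd Xc
      by simp
    then have B: "\<bar>integral {X c..X d} G - (X d - X c) * G0\<bar> \<le> \<epsilon> * (X d - X c)"
    proof -
      assume h: "((\<lambda>x. G x - G0) has_integral (integral {X c..X d} G - (X d - X c) * G0)) {X c..X d}"
      have "norm (G y - G0) \<le> \<epsilon>" if "y \<in> {X c..X d}" for y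
      proof -
        \<comment> \<open>The hypothesis controls \<open>G\<close> only at values of
          \<open>X\<close>; by the intermediate value theorem these fill the whole image
          interval.\<close>
        have "\<exists>s\<ge>c. s \<le> d \<and> X s = y"
          by (rule IVT') (use that cd in \<open>auto intro: continuous_on_subset[OF cont]\<close>)
        then obtain s where "c \<le> s" "s \<le> d" "X s = y" by blast
        then show ?thesis using \<epsilon>[of s] by auto
      qed
      with has_integral_bound_real[OF \<open>\<epsilon> \<ge> 0\<close> finite.emptyI h] X_cd show ?thesis by auto
    qed
    have "\<bar>D d - D c\<bar> \<le> 2 * \<epsilon> * (X d - X c)"
      using A B 1 2 unfolding D_def by linarith
    also have "\<dots> \<le> 2 * \<epsilon> * (L * (d - c))"
      using X_cd \<open>\<epsilon> \<ge> 0\<close> by (intro mult_left_mono) auto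
    finally show ?thesis by (simp add: mult.assoc)
  qed
  have "(D has_field_derivative 0) (at x within {a..b})" if x: "x \<in> {a..b}" for x
    unfolding has_field_derivative_iff Lim_within
  proof (intro allI impI)
    fix e :: real assume "e > 0"
    \<comment> \<open>Then \<open>2 * \<epsilon> * L = e * L / (2 * (L + 1))\<close>, which is below
      \<open>e\<close> also for \<open>L = 0\<close>.\<close>
    define \<epsilon> where "\<epsilon> = e / (4 * (L + 1))"
    have "\<epsilon> > 0" using \<open>e > 0\<close> \<open>L \<ge> 0\<close> by (simp add: \<epsilon>_def)
    then obtain \<delta> where "\<delta> > 0" and \<delta>: "\<And>y. y \<in> {a..b} \<Longrightarrow> dist y x < \<delta> \<Longrightarrow> dist (G (X y)) (G (X x)) < \<epsilon>"
      using GX x unfolding continuous_on_iff by blast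
    have main: "\<bar>D y - D x\<bar> \<le> 2 * \<epsilon> * L * \<bar>y - x\<bar>" if y: "y \<in> {a..b}" "dist y x < \<delta>" for y
    proof (cases "x \<le> y")
      case True
      have "\<bar>D y - D x\<bar> \<le> 2 * \<epsilon> * L * (y - x)"
        by (rule D_inc[of _ _ "G (X x)"]) (use x y True \<delta> in \<open>force simp: dist_real_def intro: less_imp_le\<close>)+
      then show ?thesis using True by simp
    next
      case False
      have "\<bar>D x - D y\<bar> \<le> 2 * \<epsilon> * L * (x - y)"
        by (rule D_inc[of _ _ "G (X x)"]) (use x y False \<delta> in \<open>force simp: dist_real_def intro: less_imp_le\<close>)+
      then show ?thesis using False by (simp add: abs_minus_commute)
    qed
    show "\<exists>d>0. \<forall>y\<in>{a..b}. 0 < dist y x \<and> dist y x < d \<longrightarrow> dist ((D y - D x) / (y - x)) 0 < e"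
    proof (intro exI[of _ \<delta>] conjI ballI impI \<open>\<delta> > 0\<close>)
      fix y assume y: "y \<in> {a..b}" "0 < dist y x \<and> dist y x < \<delta>"
      have "2 * \<epsilon> * L < e"
        using \<open>e > 0\<close> \<open>L \<ge> 0\<close> by (simp add: \<epsilon>_def field_simps) (smt (verit) mult_nonneg_nonneg)
      moreover have "\<bar>y - x\<bar> > 0" using y by (simp add: dist_real_def)
      ultimately have "\<bar>D y - D x\<bar> < e * \<bar>y - x\<bar>"
        using main[of y] y mult_strict_right_mono[of "2 * \<epsilon> * L" e "\<bar>y - x\<bar>"] by linarith
      then show "dist ((D y - D x) / (y - x)) 0 < e"
        using \<open>\<bar>y - x\<bar> > 0\<close> by (simp add: dist_real_def abs_divide pos_divide_less_eq)
    qed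
  qed
  then obtain k where k: "\<And>x. x \<in> {a..b} \<Longrightarrow> D x = k"
    using has_field_derivative_zero_constant[of "{a..b}" D] by auto
  have "D b = D a" using k ab by auto
  then have "integral {a..b} (\<lambda>x. \<gamma> x * G (X x)) = integral {a..b} G"
    using Xa Xb by (simp add: D_def)
  then show ?thesis
    using integral_unique[OF integrable_Om_has_integral[OF iGX]]
      integral_unique[OF integrable_Om_has_integral[OF integrable_Om_continuous[OF G]]] by simp
qed

section \<open>The upwind step\<close>

text \<open>A negative essential supremum would put a nonnegative function below a negative number
  almost everywhere, impossible on an interval of positive length.\<close>

lemma Linf_norm_nonneg:
  assumes "a < b"
  shows "0 \<le> Linf_norm a b f"
proof -
  have "0 \<le> esssup (Om a b) (\<lambda>x. ereal \<bar>f x\<bar>)"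
  proof (rule ccontr)
    assume neg: "\<not> 0 \<le> esssup (Om a b) (\<lambda>x. ereal \<bar>f x\<bar>)"
    have "AE x in Om a b. False"
      using esssup_AE[where M="Om a b" and f="\<lambda>x. ereal \<bar>f x\<bar>"]
    proof eventually_elim
      case (elim x)
      moreover have "0 \<le> ereal \<bar>f x\<bar>" by simp
      ultimately show ?case using neg order_trans by blast
    qed
    then have "emeasure (Om a b) (space (Om a b)) = 0"
      using ae_filter_eq_bot_iff[of "Om a b"] by (simp only: trivial_limit_def)
    then show False using assms by (simp add: emeasure_restrict_space)
  qed
  then show ?thesis unfolding Linf_norm_def by (rule real_of_ereal_pos)
qed

lemma Linf_AE_bound:
  assumes "f \<in> Linf a b"
  shows "AE x in Om a b. \<bar>f x\<bar> \<le> Linf_norm a b f"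
  using esssup_AE[where M="Om a b" and f="\<lambda>x. ereal \<bar>f x\<bar>"]
proof eventually_elim
  case (elim x)
  then show ?case using assms
    by (cases "esssup (Om a b) (\<lambda>x. ereal \<bar>f x\<bar>)") (auto simp: Linf_def Linf_norm_def)
qed

lemma LinfI:
  assumes "f \<in> borel_measurable (Om a b)" "AE x in Om a b. \<bar>f x\<bar> \<le> c" "0 \<le> c"
  shows "f \<in> Linf a b" "Linf_norm a b f \<le> c"
proof -
  have le: "esssup (Om a b) (\<lambda>x. ereal \<bar>f x\<bar>) \<le> ereal c"
    using assms by (intro esssup_I) auto
  then show "f \<in> Linf a b" by (auto simp: Linf_def intro: le_less_trans)
  show "Linf_norm a b f \<le> c"
    using le \<open>0 \<le> c\<close> unfolding Linf_norm_def
    by (cases "esssup (Om a b) (\<lambda>x. ereal \<bar>f x\<bar>)") auto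
qed

lemma weak_deriv_measurable:
  "has_weak_deriv a b w v \<Longrightarrow> weak_deriv a b w \<in> borel_measurable (Om a b)"
  using has_weak_deriv_weak_deriv[of a b w v] by (auto simp: has_weak_deriv_def)

lemma W1inf0_weak_deriv:
  assumes "a < b" "w \<in> W1inf0 a b"
  shows "has_weak_deriv a b w (weak_deriv a b w)" "weak_deriv a b w \<in> Linf a b"
proof -
  obtain v where v: "v \<in> Linf a b" "has_weak_deriv a b w v" and cont: "continuous_on {a..b} w"
    using assms by (auto simp: W1inf0_def)
  show "has_weak_deriv a b w (weak_deriv a b w)" by (rule has_weak_deriv_weak_deriv[OF v(2)])
  have "AE x in Om a b. \<bar>weak_deriv a b w x\<bar> \<le> Linf_norm a b v"
    using weak_deriv_AE_eq[OF cont v(2)] Linf_AE_bound[OF v(1)] by eventually_elim simp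
  then show "weak_deriv a b w \<in> Linf a b"
    by (rule LinfI(1)[OF weak_deriv_measurable[OF v(2)] _ Linf_norm_nonneg[OF assms(1)]])
qed

lemma Linf_norm_weak_deriv_le:
  assumes ab: "a < b" and w: "w \<in> W1inf0 a b" "w' \<in> W1inf0 a b"
  shows "Linf_norm a b (weak_deriv a b w) \<le> Linf_norm a b (weak_deriv a b w') + W1inf_norm a b (\<lambda>x. w x - w' x)"
proof -
  note wd = W1inf0_weak_deriv[OF ab w(1)] W1inf0_weak_deriv[OF ab w(2)]
  let ?v = "weak_deriv a b w" let ?v' = "weak_deriv a b w'"
  let ?d = "weak_deriv a b (\<lambda>x. w x - w' x)"
  have cont: "continuous_on {a..b} (\<lambda>x. w x - w' x)"
    using w by (auto simp: W1inf0_def intro!: continuous_intros)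
  have hd: "has_weak_deriv a b (\<lambda>x. w x - w' x) (\<lambda>x. ?v x - ?v' x)"
    using has_weak_deriv_lincomb[OF wd(1,3), of 1 "-1"] by simp
  have d_eq: "AE x in Om a b. ?d x = ?v x - ?v' x" by (rule weak_deriv_AE_eq[OF cont hd])
  have "AE x in Om a b. \<bar>?d x\<bar> \<le> Linf_norm a b ?v + Linf_norm a b ?v'"
    using d_eq Linf_AE_bound[OF wd(2)] Linf_AE_bound[OF wd(4)] by eventually_elim simp
  then have "?d \<in> Linf a b"
    using LinfI(1)[OF weak_deriv_measurable[OF hd]] Linf_norm_nonneg[OF ab] by (meson add_nonneg_nonneg)
  from Linf_AE_bound[OF this] have "AE x in Om a b. \<bar>?v x\<bar> \<le> Linf_norm a b ?v' + Linf_norm a b ?d"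
    using d_eq Linf_AE_bound[OF wd(4)] by eventually_elim linarith
  then have "Linf_norm a b ?v \<le> Linf_norm a b ?v' + Linf_norm a b ?d"
    by (rule LinfI(2)[OF weak_deriv_measurable[OF wd(1)]]) (simp add: Linf_norm_nonneg[OF ab])
  then show ?thesis
    using Linf_norm_nonneg[OF ab, of "\<lambda>x. w x - w' x"] by (simp add: W1inf_norm_def)
qed

text \<open>A real supremum dominates its members only when they are bounded. Continuity in time and
  the preceding triangle inequality bound them near each time; \<open>Bolzano\<close> supplies the
  compactness of [0,T].\<close>

lemma C_W1inf_seminorm_upper:
  assumes ab: "a < b" and "0 \<le> T" and u: "u \<in> C_W1inf0 T a b" and t: "t \<in> {0..T}"
  shows "Linf_norm a b (weak_deriv a b (u t)) \<le> C_W1inf_seminorm T a b u"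
proof -
  let ?N = "\<lambda>t. Linf_norm a b (weak_deriv a b (u t))"
  have uW: "u t \<in> W1inf0 a b" if "t \<in> {0..T}" for t using u that by (auto simp: C_W1inf0_def)
  have "\<exists>K. \<forall>s\<in>{0..T} \<inter> {0..T}. ?N s \<le> K"
  proof (rule Bolzano[OF \<open>0 \<le> T\<close>, of "\<lambda>c d. \<exists>K. \<forall>s\<in>{c..d} \<inter> {0..T}. ?N s \<le> K"])
    fix c d e assume "\<exists>K. \<forall>s\<in>{c..d} \<inter> {0..T}. ?N s \<le> K" "\<exists>K. \<forall>s\<in>{d..e} \<inter> {0..T}. ?N s \<le> K"
    then obtain K K' where "\<forall>s\<in>{c..d} \<inter> {0..T}. ?N s \<le> K" "\<forall>s\<in>{d..e} \<inter> {0..T}. ?N s \<le> K'" by blast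
    then show "\<exists>K. \<forall>s\<in>{c..e} \<inter> {0..T}. ?N s \<le> K"
      by (intro exI[of _ "max K K'"]) (auto simp: le_max_iff_disj)
  next
    fix t assume "0 \<le> t" "t \<le> T"
    then have t: "t \<in> {0..T}" by simp
    then have "((\<lambda>s. W1inf_norm a b (\<lambda>x. u s x - u t x)) \<longlongrightarrow> 0) (at t within {0..T})"
      using u by (auto simp: C_W1inf0_def)
    then have "\<forall>\<^sub>F s in at t within {0..T}. W1inf_norm a b (\<lambda>x. u s x - u t x) < 1"
      by (rule order_tendstoD) simp
    then obtain \<delta> where "\<delta> > 0" and \<delta>: "\<And>s. s \<in> {0..T} \<Longrightarrow> s \<noteq> t \<Longrightarrow> dist s t < \<delta> \<Longrightarrow>
        W1inf_norm a b (\<lambda>x. u s x - u t x) < 1"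
      unfolding eventually_at by blast
    have "?N s \<le> ?N t + 1" if "s \<in> {0..T}" "dist s t < \<delta>" for s
    proof (cases "s = t")
      case False
      then show ?thesis
        using Linf_norm_weak_deriv_le[OF ab uW[OF that(1)] uW[OF t]] \<delta>[OF that(1) False that(2)] by linarith
    qed simp
    then show "\<exists>\<delta>>0. \<forall>c d. c \<le> t \<and> t \<le> d \<and> d - c < \<delta> \<longrightarrow> (\<exists>K. \<forall>s\<in>{c..d} \<inter> {0..T}. ?N s \<le> K)"
      using \<open>\<delta> > 0\<close> by (intro exI[of _ \<delta>]) (force simp: dist_real_def)
  qed
  then have "bdd_above (?N ` {0..T})" by (auto simp: bdd_above_def)
  then show ?thesis unfolding C_W1inf_seminorm_def using t by (rule cSUP_upper2) simp
qed

section \<open>Energy inequality for one transport step\<close>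

lemma L2_norm_power2: "(L2_norm a b f)\<^sup>2 = (LINT x|Om a b. f x * f x)"
  unfolding L2_norm_def L2_inner_def by (rule real_sqrt_pow2) (rule Bochner_Integration.integral_nonneg, simp)

lemma L2_norm_nonneg: "0 \<le> L2_norm a b f"
  unfolding L2_norm_def L2_inner_def by (rule real_sqrt_ge_zero) (rule Bochner_Integration.integral_nonneg, simp)

text \<open>With Y the transported function, the right side is the integral of 2 (\<psi> - Y)
  \<psi>, which is at least |\<psi>|^2 - |Y|^2. The smallness of \<open>\<Delta>t * M\<close> makes
  the derivative of \<open>X\<close> nonnegative.\<close>

lemma upwind_energy_estimate:
  assumes ab: "a < b" and w: "w \<in> W1inf0 a b" and "\<Delta>t > 0"
    and M: "Linf_norm a b (weak_deriv a b w) \<le> M" and small: "\<Delta>t * M \<le> 1"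
    and \<rho>: "continuous_on {a..b} \<rho>" and \<psi>: "continuous_on {a..b} \<psi>"
  defines "X \<equiv> upwind \<Delta>t w"
  shows "(L2_norm a b \<psi>)\<^sup>2 - (1 + \<Delta>t * M) * (L2_norm a b \<rho>)\<^sup>2
    \<le> 2 * \<Delta>t * L2_inner a b (\<lambda>x. (\<psi> x - \<rho> (X x) * weak_deriv a b X x) / \<Delta>t) \<psi>"
proof -
  note wd = W1inf0_weak_deriv[OF ab w]
  let ?v = "weak_deriv a b w" let ?\<gamma> = "weak_deriv a b X"
  define L where "L = 1 + \<Delta>t * M"
  have "M \<ge> 0" using M Linf_norm_nonneg[OF ab, of ?v] by linarith
  then have "L \<ge> 1" using \<open>\<Delta>t > 0\<close> by (simp add: L_def)
  have cont_w: "continuous_on {a..b} w" and w0: "w a = 0" "w b = 0" using w by (auto simp: W1inf0_def)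
  have X: "X = (\<lambda>x. 1 * x + (- \<Delta>t) * w x)" by (simp add: X_def upwind_def fun_eq_iff)
  have cont_X: "continuous_on {a..b} X" unfolding X by (intro continuous_intros cont_w)
  have id: "has_weak_deriv a b (\<lambda>x. x) (\<lambda>_. 1)"
    by (rule has_weak_deriv_piecewise[of _ _ "{}"]) (use ab in \<open>auto intro!: integrable_Om_continuous\<close>)
  have hX: "has_weak_deriv a b X (\<lambda>x. 1 * 1 + (- \<Delta>t) * ?v x)"
    unfolding X by (rule has_weak_deriv_lincomb[OF id wd(1)])
  have \<gamma>_meas: "?\<gamma> \<in> borel_measurable (Om a b)" by (rule weak_deriv_measurable[OF hX])
  txt \<open>The bounds on \<open>\<partial>X\<close> hold only almost everywhere; clipping makes them hold everywhere.\<close>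
  define \<gamma> where "\<gamma> x = max 0 (min L (?\<gamma> x))" for x
  have \<gamma>_eq: "AE x in Om a b. ?\<gamma> x = \<gamma> x"
    using weak_deriv_AE_eq[OF cont_X hX] Linf_AE_bound[OF wd(2)]
  proof eventually_elim
    case (elim x)
    then have "\<bar>?v x\<bar> \<le> M" using M by linarith
    then have "\<Delta>t * \<bar>?v x\<bar> \<le> \<Delta>t * M" using \<open>\<Delta>t > 0\<close> by simp
    then have "\<bar>\<Delta>t * ?v x\<bar> \<le> \<Delta>t * M" using \<open>\<Delta>t > 0\<close> by (simp add: abs_mult)
    with elim small show ?case unfolding \<gamma>_def L_def by (auto simp: max_def min_def abs_le_iff)
  qed
  have \<gamma>_meas': "\<gamma> \<in> borel_measurable (Om a b)" unfolding \<gamma>_def using \<gamma>_meas by measurable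
  have h\<gamma>: "has_weak_deriv a b X \<gamma>"
    by (rule has_weak_deriv_cong_AE[OF has_weak_deriv_weak_deriv[OF hX] \<gamma>_meas' \<gamma>_eq])
  have \<gamma>_bd: "0 \<le> \<gamma> x" "\<gamma> x \<le> L" for x using \<open>L \<ge> 1\<close> by (auto simp: \<gamma>_def)
  have Xab: "X a = a" "X b = b" using w0 by (auto simp: X)
  have X_in: "X x \<in> {a..b}" if "x \<in> {a..b}" for x
    using has_weak_deriv_bounded_increment(1)[OF cont_X h\<gamma> \<gamma>_bd, of a x]
      has_weak_deriv_bounded_increment(1)[OF cont_X h\<gamma> \<gamma>_bd, of x b] that Xab by auto
  have \<rho>X: "continuous_on {a..b} (\<lambda>x. \<rho> (X x))"
    by (rule continuous_on_compose2[OF \<rho> cont_X]) (use X_in in auto)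
  note c_meas = borel_measurable_integrable[OF integrable_Om_continuous]
  have \<gamma>_int: "integrable (Om a b) \<gamma>" using h\<gamma> by (simp add: has_weak_deriv_def)
  have i1: "integrable (Om a b) (\<lambda>x. \<gamma> x * (\<rho> (X x) * \<rho> (X x)))"
    by (intro integrable_Om_mult_continuous \<gamma>_int continuous_intros \<rho>X)
  have i2: "integrable (Om a b) (\<lambda>x. (\<gamma> x * (\<rho> (X x) * \<rho> (X x))) * \<gamma> x)"
    by (rule integrable_Om_mult_bounded[OF i1 \<gamma>_meas', of L]) (use \<gamma>_bd in \<open>simp add: abs_of_nonneg\<close>)
  have i3: "integrable (Om a b) (\<lambda>x. \<gamma> x * (\<rho> (X x) * \<psi> x))"
    by (intro integrable_Om_mult_continuous \<gamma>_int continuous_intros \<rho>X \<psi>)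
  have i4: "integrable (Om a b) (\<lambda>x. \<psi> x * \<psi> x)"
    by (intro integrable_Om_continuous continuous_intros \<psi>)
  \<comment> \<open>One factor \<gamma> is replaced by its bound \<open>L\<close>; the other remains
    for the substitution.\<close>
  have "(LINT x|Om a b. (\<gamma> x * (\<rho> (X x) * \<rho> (X x))) * \<gamma> x) \<le> (LINT x|Om a b. L * (\<gamma> x * (\<rho> (X x) * \<rho> (X x))))"
    using \<gamma>_bd by (intro integral_mono i2 integrable_mult_right i1) (simp add: mult_right_mono mult.commute)
  also have "\<dots> = L * (LINT x|Om a b. \<rho> x * \<rho> x)"
    using integral_substitution_weak_deriv_bounded[OF _ cont_X h\<gamma> Xab \<gamma>_bd, of "\<lambda>x. \<rho> x * \<rho> x"] ab \<rho>
    by (simp add: continuous_on_mult)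
  finally have A: "(LINT x|Om a b. (\<gamma> x * (\<rho> (X x) * \<rho> (X x))) * \<gamma> x) \<le> L * (L2_norm a b \<rho>)\<^sup>2"
    by (simp add: L2_norm_power2)
  have "2 * \<Delta>t * L2_inner a b (\<lambda>x. (\<psi> x - \<rho> (X x) * ?\<gamma> x) / \<Delta>t) \<psi>
      = (LINT x|Om a b. 2 * \<Delta>t * ((\<psi> x - \<rho> (X x) * ?\<gamma> x) / \<Delta>t * \<psi> x))"
    unfolding L2_inner_def by (simp only: integral_mult_right_zero)
  also have "\<dots> = (LINT x|Om a b. 2 * (\<psi> x * \<psi> x) - 2 * (\<gamma> x * (\<rho> (X x) * \<psi> x)))"
  proof (rule integral_cong_AE)
    show "(\<lambda>x. 2 * \<Delta>t * ((\<psi> x - \<rho> (X x) * ?\<gamma> x) / \<Delta>t * \<psi> x)) \<in> borel_measurable (Om a b)"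
      using c_meas[OF \<psi>] c_meas[OF \<rho>X] \<gamma>_meas by measurable
    show "(\<lambda>x. 2 * (\<psi> x * \<psi> x) - 2 * (\<gamma> x * (\<rho> (X x) * \<psi> x))) \<in> borel_measurable (Om a b)"
      using c_meas[OF \<psi>] c_meas[OF \<rho>X] \<gamma>_meas' by measurable
    show "AE x in Om a b. 2 * \<Delta>t * ((\<psi> x - \<rho> (X x) * ?\<gamma> x) / \<Delta>t * \<psi> x) = 2 * (\<psi> x * \<psi> x) - 2 * (\<gamma> x * (\<rho> (X x) * \<psi> x))"
      using \<gamma>_eq by eventually_elim (use \<open>\<Delta>t > 0\<close> in \<open>simp add: field_simps\<close>)
  qed
  \<comment> \<open>The two integrands differ by the square of
    \<open>\<psi> x - \<gamma> x * \<rho> (X x)\<close>.\<close>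
  also have "\<dots> \<ge> (LINT x|Om a b. \<psi> x * \<psi> x - (\<gamma> x * (\<rho> (X x) * \<rho> (X x))) * \<gamma> x)"
  proof (intro integral_mono Bochner_Integration.integrable_diff integrable_mult_right i2 i3 i4)
    fix x
    have "0 \<le> (\<psi> x - \<gamma> x * \<rho> (X x))\<^sup>2" by simp
    then show "\<psi> x * \<psi> x - (\<gamma> x * (\<rho> (X x) * \<rho> (X x))) * \<gamma> x \<le> 2 * (\<psi> x * \<psi> x) - 2 * (\<gamma> x * (\<rho> (X x) * \<psi> x))"
      by (simp add: power2_eq_square algebra_simps)
  qed
  also have "(LINT x|Om a b. \<psi> x * \<psi> x - (\<gamma> x * (\<rho> (X x) * \<rho> (X x))) * \<gamma> x)
     = (L2_norm a b \<psi>)\<^sup>2 - (LINT x|Om a b. (\<gamma> x * (\<rho> (X x) * \<rho> (X x))) * \<gamma> x)"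
    using i2 i4 by (simp add: L2_norm_power2)
  finally show ?thesis using A unfolding L_def by linarith
qed

section \<open>Energy estimate for the scheme\<close>

lemma fe_space_scale:
  assumes "\<psi> \<in> fe_space a b Np p"
  shows "(\<lambda>x. c * \<psi> x) \<in> fe_space a b Np p"
  unfolding fe_space_def
proof (intro CollectI conjI ballI)
  show "continuous_on {a..b} (\<lambda>x. c * \<psi> x)"
    using assms by (auto simp: fe_space_def intro!: continuous_intros)
  fix i assume "i \<in> {1..<Np}"
  then obtain \<alpha> \<beta> where "\<forall>x\<in>{p i..p (Suc i)}. \<psi> x = \<alpha> + \<beta> * x"
    using assms unfolding fe_space_def by blast
  then show "\<exists>\<alpha> \<beta>. \<forall>x\<in>{p i..p (Suc i)}. c * \<psi> x = \<alpha> + \<beta> * x"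
    by (intro exI[of _ "c * \<alpha>"] exI[of _ "c * \<beta>"]) (auto simp: algebra_simps)
qed

lemma mesh_interval_exists:
  fixes p :: "nat \<Rightarrow> real"
  assumes "p 1 < x" "x < p Np" "x \<notin> p ` {1..Np}" "2 \<le> Np"
  obtains i where "i \<in> {1..<Np}" "p i < x" "x < p (Suc i)"
proof -
  define i where "i = Max {i \<in> {1..Np}. p i < x}"
  have "1 \<in> {i \<in> {1..Np}. p i < x}" using assms by auto
  then have i: "i \<in> {i \<in> {1..Np}. p i < x}" unfolding i_def by (intro Max_in) auto
  then have "i \<noteq> Np" using assms by auto
  then have i': "i \<in> {1..<Np}" using i by auto
  have "\<not> p (Suc i) < x"
  proof
    assume "p (Suc i) < x"
    then have "Suc i \<in> {i \<in> {1..Np}. p i < x}" using i' by auto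
    then have "Suc i \<le> i" unfolding i_def by (intro Max_ge) auto
    then show False by simp
  qed
  moreover have "x \<noteq> p (Suc i)" using assms(3) i' by auto
  ultimately show ?thesis using that[OF i'] i by auto
qed

text \<open>The weak derivative is the step function of the slopes. The inclusion lets functionals
  in \<open>H1_dual\<close> act boundedly on the discrete space.\<close>

lemma fe_space_subset_H1:
  assumes "2 \<le> Np" "p 1 = a" "p Np = b" and mono: "strict_mono_on {1..Np} p"
  shows "fe_space a b Np p \<subseteq> H1 a b"
proof
  fix \<psi> assume \<psi>: "\<psi> \<in> fe_space a b Np p"
  then have cont: "continuous_on {a..b} \<psi>" by (simp add: fe_space_def)
  have "\<forall>i\<in>{1..<Np}. \<exists>\<beta> \<alpha>. \<forall>x\<in>{p i..p (Suc i)}. \<psi> x = \<alpha> + \<beta> * x"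
    using \<psi> unfolding fe_space_def by blast
  then obtain \<beta> where \<beta>: "\<And>i. i \<in> {1..<Np} \<Longrightarrow> \<exists>\<alpha>. \<forall>x\<in>{p i..p (Suc i)}. \<psi> x = \<alpha> + \<beta> i * x"
    by metis
  \<comment> \<open>Half-open cells are disjoint, so each point lies in at most one of them.\<close>
  define v where "v x = (\<Sum>i\<in>{1..<Np}. \<beta> i * indicator {p i..<p (Suc i)} x)" for x
  have v_meas: "v \<in> borel_measurable borel" unfolding v_def by measurable
  have v_bound: "\<bar>v x\<bar> \<le> (\<Sum>i\<in>{1..<Np}. \<bar>\<beta> i\<bar>)" for x
    unfolding v_def by (rule order_trans[OF sum_abs]) (auto intro!: sum_mono simp: indicator_def)
  have ab: "a \<le> b"
    using assms strict_mono_onD[OF mono, of 1 Np] by auto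
  have one: "integrable (Om a b) (\<lambda>x. 1 :: real)" by (intro integrable_Om_continuous continuous_intros)
  have v_int: "integrable (Om a b) v"
    using integrable_Om_mult_bounded[OF one borel_measurable_Om[OF v_meas] v_bound] by simp
  have v_sq: "integrable (Om a b) (\<lambda>x. (v x)\<^sup>2)"
    using integrable_Om_mult_bounded[OF v_int borel_measurable_Om[OF v_meas] v_bound] by (simp add: power2_eq_square)
  have "has_weak_deriv a b \<psi> v"
  proof (rule has_weak_deriv_piecewise[OF ab _ cont _ v_int])
    show "finite (p ` {1..Np})" by simp
    fix x assume x: "x \<in> {a<..<b} - p ` {1..Np}"
    then obtain i where i: "i \<in> {1..<Np}" "p i < x" "x < p (Suc i)"
      using mesh_interval_exists[of p x Np] assms by auto
    have "v x = (\<Sum>j\<in>{1..<Np}. if j = i then \<beta> j else 0)"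
      unfolding v_def
    proof (rule sum.cong[OF refl])
      fix j assume j: "j \<in> {1..<Np}"
      have "x \<notin> {p j..<p (Suc j)}" if "j \<noteq> i"
      proof -
        have "j < i \<or> i < j" using that by linarith
        then have "p (Suc j) \<le> p i \<or> p (Suc i) \<le> p j"
          using strict_mono_on_leD[OF mono, of "Suc j" i] strict_mono_on_leD[OF mono, of "Suc i" j] i j by auto
        then show ?thesis using i by auto
      qed
      then show "\<beta> j * indicator {p j..<p (Suc j)} x = (if j = i then \<beta> j else 0)"
        using i by auto
    qed
    then have v: "v x = \<beta> i" using i by simp
    obtain \<alpha> where \<alpha>: "\<And>y. y \<in> {p i..p (Suc i)} \<Longrightarrow> \<psi> y = \<alpha> + \<beta> i * y" using \<beta>[OF i(1)] by blast
    have "((\<lambda>y. \<alpha> + \<beta> i * y) has_field_derivative v x) (at x)"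
      unfolding v by (auto intro!: derivative_eq_intros)
    then show "(\<psi> has_field_derivative v x) (at x)"
      by (rule has_field_derivative_transform_within_open[of _ _ _ "{p i<..<p (Suc i)}"]) (use i \<alpha> in auto)
  qed
  moreover have "v \<in> L2 a b"
    using v_sq borel_measurable_Om[OF v_meas] by (simp add: L2_def)
  moreover have "\<psi> \<in> L2 a b"
    using cont borel_measurable_integrable[OF integrable_Om_continuous[OF cont]]
    by (auto simp: L2_def intro!: integrable_Om_continuous continuous_intros)
  ultimately show "\<psi> \<in> H1 a b" using cont by (auto simp: H1_def)
qed

text \<open>The derivative of the multiple is chosen anew and equals \<open>c\<close> times the old
  choice only almost everywhere, which suffices for the norm.\<close>

lemma H1_norm_scale:
  assumes "\<psi> \<in> H1 a b"
  shows "H1_norm a b (\<lambda>x. c * \<psi> x) = \<bar>c\<bar> * H1_norm a b \<psi>"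
proof -
  obtain v where cont: "continuous_on {a..b} \<psi>" and v: "has_weak_deriv a b \<psi> v"
    using assms by (auto simp: H1_def)
  note wd = has_weak_deriv_weak_deriv[OF v]
  have hc: "has_weak_deriv a b (\<lambda>x. c * \<psi> x) (\<lambda>x. c * weak_deriv a b \<psi> x)"
    using has_weak_deriv_lincomb[OF wd wd, of c 0] by simp
  have ae: "AE x in Om a b. weak_deriv a b (\<lambda>x. c * \<psi> x) x = c * weak_deriv a b \<psi> x"
    by (rule weak_deriv_AE_eq[OF _ hc]) (intro continuous_intros cont)
  have sq: "(L2_norm a b (\<lambda>x. c * f x))\<^sup>2 = c\<^sup>2 * (L2_norm a b f)\<^sup>2" for f :: "real \<Rightarrow> real"
  proof -
    have "(LINT x|Om a b. c * f x * (c * f x)) = (LINT x|Om a b. c\<^sup>2 * (f x * f x))"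
      by (simp add: power2_eq_square mult_ac)
    then show ?thesis by (simp only: L2_norm_power2 integral_mult_right_zero)
  qed
  have "(L2_norm a b (weak_deriv a b (\<lambda>x. c * \<psi> x)))\<^sup>2 = (L2_norm a b (\<lambda>x. c * weak_deriv a b \<psi> x))\<^sup>2"
    unfolding L2_norm_power2
  proof (rule integral_cong_AE)
    show "(\<lambda>x. weak_deriv a b (\<lambda>x. c * \<psi> x) x * weak_deriv a b (\<lambda>x. c * \<psi> x) x) \<in> borel_measurable (Om a b)"
      by (intro borel_measurable_times weak_deriv_measurable[OF hc])
    show "(\<lambda>x. c * weak_deriv a b \<psi> x * (c * weak_deriv a b \<psi> x)) \<in> borel_measurable (Om a b)"
      by (intro borel_measurable_times weak_deriv_measurable[OF v] borel_measurable_const)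
    show "AE x in Om a b. weak_deriv a b (\<lambda>x. c * \<psi> x) x * weak_deriv a b (\<lambda>x. c * \<psi> x) x
        = c * weak_deriv a b \<psi> x * (c * weak_deriv a b \<psi> x)"
      using ae by eventually_elim simp
  qed
  then have "H1_norm a b (\<lambda>x. c * \<psi> x) = sqrt (c\<^sup>2 * ((L2_norm a b \<psi>)\<^sup>2 + (L2_norm a b (weak_deriv a b \<psi>))\<^sup>2))"
    by (simp add: H1_norm_def sq distrib_left)
  then show ?thesis by (simp add: H1_norm_def real_sqrt_mult)
qed

text \<open>By normalisation of \<psi>. The supremum in \<open>dual_norm\<close> is an upper bound
  thanks to the boundedness contained in \<open>H1_dual\<close>.\<close>

lemma dual_norm_bound:
  assumes L: "L \<in> H1_dual a b" and V: "V \<subseteq> H1 a b" and scale: "\<And>c \<psi>. \<psi> \<in> V \<Longrightarrow> (\<lambda>x. c * \<psi> x) \<in> V"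
    and \<psi>: "\<psi> \<in> V"
  shows "\<bar>L \<psi>\<bar> \<le> dual_norm a b V L * H1_norm a b \<psi>"
proof -
  obtain K where K: "\<And>\<psi>. \<psi> \<in> H1 a b \<Longrightarrow> \<bar>L \<psi>\<bar> \<le> K * H1_norm a b \<psi>"
    and hom: "\<And>c \<psi>. \<psi> \<in> H1 a b \<Longrightarrow> L (\<lambda>x. c * \<psi> x) = c * L \<psi>"
    using L unfolding H1_dual_def by blast
  have nonneg: "0 \<le> H1_norm a b \<psi>" for \<psi> by (simp add: H1_norm_def)
  show ?thesis
  proof (cases "H1_norm a b \<psi> = 0")
    case True
    \<comment> \<open>No normalisation is possible here; boundedness of \<open>L\<close> gives
      \<open>L \<psi> = 0\<close>.\<close>
    then show ?thesis using K[of \<psi>] \<psi> V by auto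
  next
    case False
    define \<theta> where "\<theta> = (\<lambda>x. (1 / H1_norm a b \<psi>) * \<psi> x)"
    have pos: "H1_norm a b \<psi> > 0" using False nonneg[of \<psi>] by linarith
    have "H1_norm a b \<theta> = 1"
      unfolding \<theta>_def using H1_norm_scale[of \<psi> a b "1 / H1_norm a b \<psi>"] \<psi> V pos by auto
    moreover have "\<theta> \<in> V" unfolding \<theta>_def by (rule scale[OF \<psi>])
    ultimately have mem: "\<theta> \<in> {\<psi> \<in> V. H1_norm a b \<psi> \<le> 1}" by simp
    have "bdd_above ((\<lambda>\<psi>. \<bar>L \<psi>\<bar>) ` {\<psi> \<in> V. H1_norm a b \<psi> \<le> 1})"
    proof (rule bdd_aboveI2)
      fix \<psi> assume "\<psi> \<in> {\<psi> \<in> V. H1_norm a b \<psi> \<le> 1}"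
      then have "\<psi> \<in> H1 a b" "H1_norm a b \<psi> \<le> 1" using V by auto
      then have "\<bar>L \<psi>\<bar> \<le> K * H1_norm a b \<psi>" using K by blast
      also have "\<dots> \<le> \<bar>K\<bar> * 1"
        using \<open>H1_norm a b \<psi> \<le> 1\<close> nonneg[of \<psi>] by (intro mult_mono) auto
      finally show "\<bar>L \<psi>\<bar> \<le> \<bar>K\<bar>" by simp
    qed
    then have "\<bar>L \<theta>\<bar> \<le> dual_norm a b V L"
      unfolding dual_norm_def using mem by (rule cSUP_upper2) simp
    moreover have "L \<theta> = (1 / H1_norm a b \<psi>) * L \<psi>"
      unfolding \<theta>_def using hom \<psi> V by blast
    ultimately show ?thesis using pos by (simp add: abs_mult field_simps)
  qed
qed

section \<open>Discrete Gronwall argument and conclusion\<close>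

text \<open>The dissipation \<open>d\<close> is carried through the induction, so that one
  inequality yields both norms. Since \<open>1 \<le> q\<close>, the sums accumulated so far may be
  multiplied by \<open>q\<close> at each step.\<close>

lemma discrete_gronwall:
  fixes x e :: "nat \<Rightarrow> real"
  assumes step: "\<And>n. 1 \<le> n \<Longrightarrow> n \<le> N \<Longrightarrow> x n + d n \<le> q * x (n - 1) + e n"
    and "1 \<le> q" and nonneg: "\<And>n. 0 \<le> d n" "\<And>n. 0 \<le> e n"
  shows "n \<le> N \<Longrightarrow> x n + (\<Sum>k=1..n. d k) \<le> q ^ n * (x 0 + (\<Sum>k=1..n. e k))"
proof (induction n)
  case (Suc n)
  have "(\<Sum>k=1..n. d k) \<le> q * (\<Sum>k=1..n. d k)"
    using \<open>1 \<le> q\<close> mult_right_mono[of 1 q "\<Sum>k=1..n. d k"] by (simp add: sum_nonneg nonneg)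
  then have "x (Suc n) + (\<Sum>k=1..Suc n. d k) \<le> q * (x n + (\<Sum>k=1..n. d k)) + e (Suc n)"
    using step[of "Suc n"] Suc.prems by (simp add: distrib_left)
  also have "\<dots> \<le> q * (q ^ n * (x 0 + (\<Sum>k=1..n. e k))) + q ^ Suc n * e (Suc n)"
  proof (intro add_mono mult_left_mono)
    show "e (Suc n) \<le> q ^ Suc n * e (Suc n)"
      using mult_right_mono[of 1 "q ^ Suc n" "e (Suc n)"] one_le_power[OF \<open>1 \<le> q\<close>, of "Suc n"] nonneg(2) by simp
  qed (use Suc \<open>1 \<le> q\<close> in auto)
  finally show ?case by (simp add: algebra_simps)
qed simp

text \<open>Young's inequality turns the source into
  \<open>F\<^sup>2 / \<epsilon> + \<epsilon> * x + \<epsilon> * d\<close>. As \<epsilon> \<le>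
  \<nu>, the last term takes at most half of the dissipation; the middle one lowers the coefficient
  of \<open>x\<close> to \<open>1 - \<epsilon> * \<Delta>t\<close>, which multiplication by
  \<open>1 + 2 * \<epsilon> * \<Delta>t\<close> repairs.\<close>

lemma energy_step:
  fixes x y d F G \<epsilon> \<nu> \<Delta>t M :: real
  assumes "0 < \<epsilon>" "\<epsilon> \<le> \<nu>" "0 < \<Delta>t" "\<epsilon> * \<Delta>t \<le> 1/2" "0 \<le> M" "0 \<le> x" "0 \<le> y" "0 \<le> d"
    and main: "x - (1 + \<Delta>t * M) * y + 2 * \<Delta>t * \<nu> * d \<le> 2 * \<Delta>t * (F * sqrt (x + d))"
  shows "x + \<Delta>t * \<nu> * d \<le> exp ((M + 2 * \<epsilon>) * \<Delta>t) * y + 2 / \<epsilon> * (\<Delta>t * F\<^sup>2)"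
proof -
  have "0 \<le> (F / sqrt \<epsilon> - sqrt \<epsilon> * sqrt (x + d))\<^sup>2" by simp
  then have "2 * (F * sqrt (x + d)) \<le> F\<^sup>2 / \<epsilon> + \<epsilon> * (x + d)"
    using assms by (simp add: power2_diff power_divide power_mult_distrib)
  also have "\<epsilon> * (x + d) \<le> \<epsilon> * x + \<nu> * d"
    using assms by (simp add: distrib_left mult_right_mono)
  finally have "\<Delta>t * (2 * (F * sqrt (x + d))) \<le> \<Delta>t * (F\<^sup>2 / \<epsilon> + (\<epsilon> * x + \<nu> * d))"
    using assms by (intro mult_left_mono) auto
  with main have 1: "(1 - \<epsilon> * \<Delta>t) * x + \<Delta>t * \<nu> * d \<le> (1 + \<Delta>t * M) * y + \<Delta>t * F\<^sup>2 / \<epsilon>"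
    by (simp add: algebra_simps)
  define z where "z = \<epsilon> * \<Delta>t"
  have z: "0 \<le> z" "z \<le> 1/2" using assms by (auto simp: z_def)
  \<comment> \<open>The product is \<open>1 + z * (1 - 2 * z)\<close>; this is where
    \<open>z \<le> 1/2\<close> enters. The same bound gives \<open>1 + 2 * z \<le> 2\<close>, the
    origin of the 2 in front of the source.\<close>
  have ge1: "1 \<le> (1 + 2 * z) * (1 - z)"
    using mult_nonneg_nonneg[OF z(1), of "1 - 2 * z"] z by (simp add: algebra_simps)
  have "x + \<Delta>t * \<nu> * d \<le> (1 + 2 * z) * (1 - z) * x + (1 + 2 * z) * (\<Delta>t * \<nu> * d)"
  proof (rule add_mono)
    show "x \<le> (1 + 2 * z) * (1 - z) * x"
      using mult_right_mono[OF ge1 \<open>0 \<le> x\<close>] by simp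
    have "0 \<le> \<Delta>t * \<nu> * d" using assms by simp
    from mult_right_mono[OF _ this, of 1 "1 + 2 * z"]
    show "\<Delta>t * \<nu> * d \<le> (1 + 2 * z) * (\<Delta>t * \<nu> * d)" using z by simp
  qed
  also have "\<dots> = (1 + 2 * z) * ((1 - \<epsilon> * \<Delta>t) * x + \<Delta>t * \<nu> * d)"
    unfolding z_def by (simp add: algebra_simps)
  also have "\<dots> \<le> (1 + 2 * z) * ((1 + \<Delta>t * M) * y + \<Delta>t * F\<^sup>2 / \<epsilon>)"
    using 1 z by (intro mult_left_mono) auto
  also have "\<dots> = (1 + 2 * z) * (1 + \<Delta>t * M) * y + (1 + 2 * z) * (\<Delta>t * F\<^sup>2 / \<epsilon>)"
    by (simp add: distrib_left mult.assoc)
  also have "\<dots> \<le> (exp (2 * z) * exp (\<Delta>t * M)) * y + 2 * (\<Delta>t * F\<^sup>2 / \<epsilon>)"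
    using z assms exp_ge_add_one_self[of "2 * z"] exp_ge_add_one_self[of "\<Delta>t * M"]
    by (intro add_mono mult_right_mono mult_mono) auto
  also have "exp (2 * z) * exp (\<Delta>t * M) = exp ((M + 2 * \<epsilon>) * \<Delta>t)"
    by (simp add: mult_exp_exp z_def algebra_simps)
  finally show ?thesis by simp
qed

theorem corollary3:
  fixes a b T \<nu> :: real and u :: "real \<Rightarrow> real \<Rightarrow> real"
  assumes "a < b" and "T > 0" and "\<nu> > 0"
    and "u \<in> C_W1inf0 T a b"
  shows "\<exists>C>0. \<forall>(f :: real \<Rightarrow> real \<Rightarrow> real) (g :: real \<Rightarrow> real \<Rightarrow> real)
           (F :: real \<Rightarrow> (real \<Rightarrow> real) \<Rightarrow> real)
           (\<Delta>t :: real) (Np :: nat) (P :: nat \<Rightarrow> nat \<Rightarrow> real) (\<phi> :: nat \<Rightarrow> real \<Rightarrow> real).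
         (\<forall>t\<in>{0<..<T}. f t \<in> L2 a b) \<longrightarrow>
         (AE t in lebesgue_on {0<..<T}. \<forall>\<psi>\<in>H1 a b.
            F t \<psi> = L2_inner a b (f t) \<psi> + (\<Sum>y\<in>{a, b}. g t y * \<psi> y)) \<longrightarrow>
         F \<in> H1_H1_dual T a b \<longrightarrow>
         \<Delta>t > 0 \<longrightarrow>
         \<Delta>t * C_W1inf_seminorm T a b u \<le> 1/8 \<longrightarrow>
         moving_mesh a b (num_steps T \<Delta>t) Np P \<longrightarrow>
         \<phi> 0 \<in> fe_space a b Np (P 0) \<longrightarrow>
         scheme_solution a b T \<nu> u F \<Delta>t Np P \<phi> \<longrightarrow>
         linf_L2_norm a b (num_steps T \<Delta>t) \<phi>
           + sqrt \<nu> * l2_L2_norm a b \<Delta>t (num_steps T \<Delta>t) (\<lambda>n. weak_deriv a b (\<phi> n))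
         \<le> C * (L2_norm a b (\<phi> 0) + l2_dual_norm a b \<Delta>t (num_steps T \<Delta>t) Np P F)"
proof -
  define M where "M = C_W1inf_seminorm T a b u"
  have uW: "u t \<in> W1inf0 a b" if "t \<in> {0..T}" for t using assms(4) that by (auto simp: C_W1inf0_def)
  have M: "Linf_norm a b (weak_deriv a b (u t)) \<le> M" if "t \<in> {0..T}" for t
    unfolding M_def using C_W1inf_seminorm_upper[OF assms(1) _ assms(4) that] assms(2) by simp
  have "0 \<le> M" using M[of 0] Linf_norm_nonneg[OF assms(1), of "weak_deriv a b (u 0)"] assms(2) by auto
  txt \<open>
    The term \<open>\<epsilon> \<Delta>t |\<phi>|\<^sup>2\<close> must be absorbed although \<open>\<nu> \<Delta>t\<close> need not be small; as \<open>\<Delta>t \<le> T\<close> whenever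
    there is a step at all, a weight of at most \<open>1 / (2 T)\<close> suffices.
  \<close>
  define \<epsilon> where "\<epsilon> = min \<nu> (1 / (2 * T))"
  have \<epsilon>: "0 < \<epsilon>" "\<epsilon> \<le> \<nu>" "\<epsilon> \<le> 1 / (2 * T)" using assms by (auto simp: \<epsilon>_def)
  \<comment> \<open>The exponential is the Gronwall factor at the final time; in
    \<open>1 + 2 / \<epsilon>\<close> the 1 covers the initial value and
    \<open>2 / \<epsilon>\<close> the source. Only \<open>T\<close>, \<nu> and, through
    \<open>M\<close>, \<open>u\<close> enter.\<close>
  define Q where "Q = exp ((M + 2 * \<epsilon>) * T) * (1 + 2 / \<epsilon>)"
  have "Q > 0" using \<epsilon> by (auto simp: Q_def intro!: mult_pos_pos add_pos_nonneg)
  show ?thesis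
  \<comment> \<open>One \<open>sqrt Q\<close> for each of the two norms on the left.\<close>
  proof (intro exI[of _ "2 * sqrt Q"] conjI allI impI)
    show "0 < 2 * sqrt Q" using \<open>Q > 0\<close> by simp
    fix F \<Delta>t Np P \<phi>
    assume F: "F \<in> H1_H1_dual T a b" and \<Delta>t: "\<Delta>t > 0"
      and small: "\<Delta>t * C_W1inf_seminorm T a b u \<le> 1/8"
      and mesh: "moving_mesh a b (num_steps T \<Delta>t) Np P"
      and \<phi>0: "\<phi> 0 \<in> fe_space a b Np (P 0)"
      and sol: "scheme_solution a b T \<nu> u F \<Delta>t Np P \<phi>"
    define N where "N = num_steps T \<Delta>t"
    have N_T: "real n * \<Delta>t \<le> T" if "n \<le> N" for n
    proof -
      have "real n \<le> real N" using that by simp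
      also have "\<dots> \<le> T / \<Delta>t"
        using assms(2) \<Delta>t by (simp add: N_def num_steps_def)
      finally show ?thesis using \<Delta>t by (simp add: field_simps)
    qed
    have \<phi>: "\<phi> n \<in> fe_space a b Np (P n)" if "n \<le> N" for n
      using \<phi>0 sol that by (cases n) (auto simp: scheme_solution_def N_def)
    define x where "x n = (L2_norm a b (\<phi> n))\<^sup>2" for n
    define d where "d n = (L2_norm a b (weak_deriv a b (\<phi> n)))\<^sup>2" for n
    define D where "D n = dual_norm a b (fe_space a b Np (P n)) (F (real n * \<Delta>t))" for n
    have step: "x n + \<Delta>t * \<nu> * d n \<le> exp ((M + 2 * \<epsilon>) * \<Delta>t) * x (n - 1) + 2 / \<epsilon> * (\<Delta>t * (D n)\<^sup>2)"
      if n: "1 \<le> n" "n \<le> N" for n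
    proof (rule energy_step[OF \<epsilon>(1,2) \<Delta>t _ \<open>0 \<le> M\<close>])
      let ?t = "real n * \<Delta>t"
      have t: "?t \<in> {0..T}" using N_T[OF n(2)] \<Delta>t by simp
      have "\<epsilon> * \<Delta>t \<le> 1 / (2 * T) * T"
        using \<epsilon> N_T[of 1] n \<Delta>t assms(2) by (intro mult_mono) auto
      then show "\<epsilon> * \<Delta>t \<le> 1/2" using assms(2) by simp
      show "0 \<le> x n" "0 \<le> x (n - 1)" "0 \<le> d n" by (auto simp: x_def d_def)
      let ?X = "upwind \<Delta>t (u ?t)"
      let ?A = "L2_inner a b (\<lambda>x. (\<phi> n x - \<phi> (n - 1) (?X x) * weak_deriv a b ?X x) / \<Delta>t) (\<phi> n)"
      have "P n 1 = a" "P n Np = b" "strict_mono_on {1..Np} (P n)" "2 \<le> Np"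
        using mesh n by (auto simp: moving_mesh_def N_def)
      note V = fe_space_subset_H1[OF \<open>2 \<le> Np\<close> this(1-3)]
      \<comment> \<open>The last time level may be \<open>T\<close> itself, where \<open>F\<close>
        is given by its continuous representative.\<close>
      have "F ?t \<in> H1_dual a b" using F t by (auto simp: H1_H1_dual_def)
      then have "\<bar>F ?t (\<phi> n)\<bar> \<le> D n * H1_norm a b (\<phi> n)"
        unfolding D_def using V fe_space_scale \<phi>[OF n(2)] by (rule dual_norm_bound)
      then have F_bd: "F ?t (\<phi> n) \<le> D n * sqrt (x n + d n)"
        by (simp add: H1_norm_def x_def d_def)
      have A: "?A + \<nu> * d n = F ?t (\<phi> n)"
        using sol n \<phi>[OF n(2)]
        by (auto simp: scheme_solution_def N_def Let_def d_def L2_norm_power2 L2_inner_def)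
      have "2 * \<Delta>t * ?A + 2 * \<Delta>t * \<nu> * d n = 2 * \<Delta>t * F ?t (\<phi> n)"
        by (simp only: A[symmetric] distrib_left mult.assoc)
      moreover have "x n - (1 + \<Delta>t * M) * x (n - 1) \<le> 2 * \<Delta>t * ?A"
        unfolding x_def
      proof (rule upwind_energy_estimate[OF assms(1) uW[OF t] \<Delta>t M[OF t]])
        show "\<Delta>t * M \<le> 1" using small by (simp add: M_def)
        show "continuous_on {a..b} (\<phi> (n - 1))" "continuous_on {a..b} (\<phi> n)"
          using \<phi>[of n] \<phi>[of "n - 1"] n by (auto simp: fe_space_def)
      qed
      moreover have "2 * \<Delta>t * F ?t (\<phi> n) \<le> 2 * \<Delta>t * (D n * sqrt (x n + d n))"
        using F_bd \<Delta>t by simp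
      ultimately show "x n - (1 + \<Delta>t * M) * x (n - 1) + 2 * \<Delta>t * \<nu> * d n \<le> 2 * \<Delta>t * (D n * sqrt (x n + d n))"
        by linarith
    qed
    define S where "S = L2_norm a b (\<phi> 0) + l2_dual_norm a b \<Delta>t N Np P F"
    define E where "E = \<Delta>t * (\<Sum>k=1..N. (D k)\<^sup>2)"
    have "0 \<le> E" using \<Delta>t by (simp add: E_def sum_nonneg)
    have dual: "l2_dual_norm a b \<Delta>t N Np P F = sqrt E" by (simp add: l2_dual_norm_def E_def D_def)
    have "0 \<le> S" using L2_norm_nonneg[of a b "\<phi> 0"] \<open>0 \<le> E\<close> by (simp add: S_def dual)
    \<comment> \<open>The cross term of the square is nonnegative.\<close>
    have S2: "x 0 + E \<le> S\<^sup>2"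
      using \<open>0 \<le> E\<close> L2_norm_nonneg[of a b "\<phi> 0"] by (simp add: S_def dual x_def power2_sum)
    have bound: "x n + (\<Sum>k=1..n. \<Delta>t * \<nu> * d k) \<le> (sqrt Q * S)\<^sup>2" if "n \<le> N" for n
    proof -
      have "x n + (\<Sum>k=1..n. \<Delta>t * \<nu> * d k)
          \<le> exp ((M + 2 * \<epsilon>) * \<Delta>t) ^ n * (x 0 + (\<Sum>k=1..n. 2 / \<epsilon> * (\<Delta>t * (D k)\<^sup>2)))"
        by (rule discrete_gronwall[where N=N and d="\<lambda>k. \<Delta>t * \<nu> * d k"])
          (use step that \<Delta>t \<epsilon> \<open>0 \<le> M\<close> assms(3) in \<open>auto simp: d_def\<close>)
      also have "\<dots> \<le> exp ((M + 2 * \<epsilon>) * T) * ((1 + 2 / \<epsilon>) * (x 0 + E))"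
      proof (intro mult_mono)
        \<comment> \<open>The power becomes an exponential at time
          \<open>real n * \<Delta>t\<close>, at most \<open>T\<close>; here the dependence on
          \<Delta>t disappears.\<close>
        have "exp ((M + 2 * \<epsilon>) * \<Delta>t) ^ n = exp ((M + 2 * \<epsilon>) * (real n * \<Delta>t))"
          by (simp add: exp_of_nat_mult[symmetric] mult_ac)
        then show "exp ((M + 2 * \<epsilon>) * \<Delta>t) ^ n \<le> exp ((M + 2 * \<epsilon>) * T)"
          using N_T[OF that] \<open>0 \<le> M\<close> \<epsilon>(1) by (simp add: mult_left_mono)
        have "(\<Sum>k=1..n. 2 / \<epsilon> * (\<Delta>t * (D k)\<^sup>2)) = 2 / \<epsilon> * (\<Delta>t * (\<Sum>k=1..n. (D k)\<^sup>2))"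
          by (simp add: sum_distrib_left)
        also have "\<dots> \<le> 2 / \<epsilon> * E"
          unfolding E_def using that \<Delta>t \<epsilon>(1) by (intro mult_left_mono sum_mono2) auto
        finally have "x 0 + (\<Sum>k=1..n. 2 / \<epsilon> * (\<Delta>t * (D k)\<^sup>2)) \<le> x 0 + 2 / \<epsilon> * E" by simp
        also have "\<dots> \<le> (1 + 2 / \<epsilon>) * (x 0 + E)"
          using \<open>0 \<le> E\<close> \<epsilon>(1) by (simp add: algebra_simps x_def)
        finally show "x 0 + (\<Sum>k=1..n. 2 / \<epsilon> * (\<Delta>t * (D k)\<^sup>2)) \<le> (1 + 2 / \<epsilon>) * (x 0 + E)" .
        show "0 \<le> x 0 + (\<Sum>k=1..n. 2 / \<epsilon> * (\<Delta>t * (D k)\<^sup>2))"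
          using \<Delta>t \<epsilon>(1) by (auto simp: x_def intro!: add_nonneg_nonneg sum_nonneg)
      qed simp
      also have "\<dots> = Q * (x 0 + E)" by (simp add: Q_def)
      also have "\<dots> \<le> Q * S\<^sup>2" using S2 \<open>Q > 0\<close> by simp
      finally show ?thesis using \<open>Q > 0\<close> by (simp add: power_mult_distrib)
    qed
    have nonneg: "0 \<le> sqrt Q * S" using \<open>Q > 0\<close> \<open>0 \<le> S\<close> by simp
    have sum_nonneg: "0 \<le> (\<Sum>k=1..n. \<Delta>t * \<nu> * d k)" for n
      using \<Delta>t assms(3) by (intro sum_nonneg) (simp add: d_def)
    have "L2_norm a b (\<phi> n) \<le> sqrt Q * S" if "n \<le> N" for n
      by (rule power2_le_imp_le[OF _ nonneg]) (use bound[OF that] sum_nonneg[of n] in \<open>simp add: x_def\<close>)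
    then have A: "linf_L2_norm a b N \<phi> \<le> sqrt Q * S"
      unfolding linf_L2_norm_def using nonneg by (subst Max_le_iff) auto
    have "sqrt \<nu> * l2_L2_norm a b \<Delta>t N (\<lambda>n. weak_deriv a b (\<phi> n)) = sqrt (\<Sum>k=1..N. \<Delta>t * \<nu> * d k)"
      by (simp add: l2_L2_norm_def d_def real_sqrt_mult[symmetric] sum_distrib_left mult_ac)
    also have "\<dots> \<le> sqrt Q * S"
      using bound[of N] nonneg by (intro real_le_lsqrt) (auto simp: x_def sum_nonneg intro: order_trans[rotated])
    finally show "linf_L2_norm a b (num_steps T \<Delta>t) \<phi>
           + sqrt \<nu> * l2_L2_norm a b \<Delta>t (num_steps T \<Delta>t) (\<lambda>n. weak_deriv a b (\<phi> n))
         \<le> 2 * sqrt Q * (L2_norm a b (\<phi> 0) + l2_dual_norm a b \<Delta>t (num_steps T \<Delta>t) Np P F)"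
      using A by (simp add: S_def N_def)
  qed
qed

end
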